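(* Let $\mathbb{D}=\{z\in\mathbb{C}:|z|<1\}$ and let $f$ be analytic on $\mathbb{D}$. Then the function $\phi_{\operatorname{Area}}(r)=(\pi r^2)^{-1}\operatorname{Area} f(r\mathbb{D})$ is strictly increasing for $0<r<1$, except when $f$ is linear, in which case $\phi_{\operatorname{Area}}$ is constant.
   Context: $r\mathbb{D}=\{z:|z|<r\}$, $f(r\mathbb{D})$ is the image set (counted without multiplicity), and $\operatorname{Area}$ is two-dimensional Lebesgue measure. A function is linear if it is of the form $az+b$ with $a,b\in\mathbb{C}$ (constants allowed). *)

theory Defs
  imports "HOL-Complex_Analysis.Complex_Analysis"
begin

definition phi_area :: "(complex \<Rightarrow> complex) \<Rightarrow> real \<Rightarrow> real" where
  "phi_area f r = measure lebesgue (f ` ball 0 r) / (pi * r^2)"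

definition linear_on_disc :: "(complex \<Rightarrow> complex) \<Rightarrow> bool" where
  "linear_on_disc f \<longleftrightarrow> (\<exists>a b. \<forall>z\<in>ball 0 1. f z = a * z + b)"

end

theory Submission
  imports Defs
begin

text \<open>
  Write \<open>U t = f ` ball 0 t\<close>, \<open>A t\<close> for its area and \<open>u w\<close> for the least modulus of a preimage of
  \<open>w\<close>, so that \<open>U t = {u < t}\<close>. The Brunn--Minkowski inequality bounds the area of the part of \<open>U t\<close>
  within distance \<open>\<delta>\<close> of the complement from below by \<open>2 \<delta> sqrt (pi A t) - o(\<delta>)\<close>. Integrating this
  over \<open>t\<close> and letting \<open>\<delta>\<close> tend to \<open>0\<close> gives the isoperimetric inequality
  \<open>2 sqrt (pi A s) (t - s) \<le> \<integral> m\<close> over \<open>U t - U s\<close>, where \<open>m w = 1 / \<bar>f' z\<bar>\<close> for a preimage \<open>z\<close> of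
  \<open>w\<close> of least modulus; no differentiability of \<open>u\<close> is needed, because \<open>u\<close> is bounded above by the
  modulus of any local inverse branch. By the change of variables formula the integral of \<open>m\<^sup>2\<close> over
  \<open>U t - U s\<close> is at most \<open>pi (t\<^sup>2 - s\<^sup>2)\<close>, so the Cauchy--Schwarz inequality yields \<open>A' \<ge> 2 A / r\<close> in
  integrated form, that is, \<open>A r / r\<^sup>2\<close> increases. Equality forces \<open>\<bar>f'\<bar>\<close> to be constant on a set of
  positive area, hence \<open>f\<close> to be linear. The argument is carried out on annuli without critical
  points; critical radii are isolated and are crossed using the monotonicity of \<open>A\<close>.
\<close>

section \<open>The Brunn--Minkowski inequality in the plane\<close>

text \<open>Translates of \<open>X\<close> by points of \<open>Y\<close>, and of \<open>Y\<close> by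
  points of \<open>X\<close>, lie in \<open>Z\<close>. With \<open>x\<close> near
  \<open>Sup X\<close> and \<open>y\<close> near \<open>Inf Y\<close>, the translate
  \<open>X + y\<close> lies essentially to the left of \<open>x + y\<close> and \<open>Y + x\<close>
  to the right; cutting them at \<open>x + y\<close> makes them disjoint and costs at most
  \<open>e\<close> in total.\<close>

lemma brunn_minkowski_real:
  fixes X Y Z :: "real set"
  assumes X: "X \<in> sets borel" "bounded X" "X \<noteq> {}"
    and Y: "Y \<in> sets borel" "bounded Y" "Y \<noteq> {}"
    and Z: "Z \<in> sets borel" "\<And>x y. x \<in> X \<Longrightarrow> y \<in> Y \<Longrightarrow> x + y \<in> Z"
  shows "emeasure lborel X + emeasure lborel Y \<le> emeasure lborel Z"
proof (rule ennreal_le_epsilon)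
  fix e :: real assume "e > 0"
  note [measurable] = X(1) Y(1) Z(1)
  have bX: "bdd_above X" and bY: "bdd_below Y"
    using X Y by (auto intro: bounded_imp_bdd_above bounded_imp_bdd_below)
  obtain x where x: "x \<in> X" "Sup X - e / 2 < x"
    using less_cSupD[of X "Sup X - e / 2"] X \<open>e > 0\<close> by auto
  obtain y where y: "y \<in> Y" "y < Inf Y + e / 2"
    using cInf_lessD[of Y "Inf Y + e / 2"] Y \<open>e > 0\<close> by auto
  let ?X = "X \<inter> {..<x}" and ?Y = "Y \<inter> {y..}"
  have "emeasure lborel X \<le> emeasure lborel (?X \<union> {x..Sup X})"
    using bX by (intro emeasure_mono) (auto intro: cSup_upper)
  also have "\<dots> \<le> emeasure lborel ?X + emeasure lborel {x..Sup X}"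
    by (intro emeasure_subadditive) auto
  also have "\<dots> \<le> emeasure lborel ?X + ennreal (e / 2)"
    using x cSup_upper[OF x(1) bX] by (intro add_left_mono) (auto intro!: ennreal_leI)
  finally have 1: "emeasure lborel X \<le> emeasure lborel ?X + ennreal (e / 2)" .
  have "emeasure lborel Y \<le> emeasure lborel (?Y \<union> {Inf Y..y})"
    using bY by (intro emeasure_mono) (auto intro: cInf_lower)
  also have "\<dots> \<le> emeasure lborel ?Y + emeasure lborel {Inf Y..y}"
    by (intro emeasure_subadditive) auto
  also have "\<dots> \<le> emeasure lborel ?Y + ennreal (e / 2)"
    using y cInf_lower[OF y(1) bY] by (intro add_left_mono) (auto intro!: ennreal_leI)
  finally have 2: "emeasure lborel Y \<le> emeasure lborel ?Y + ennreal (e / 2)" .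
  have translate: "emeasure lborel ((+) (-c) -` S) = emeasure lborel S" if [measurable]: "S \<in> sets borel"
    for c :: real and S
    by (subst (2) lborel_distr_plus[of "-c", symmetric]) (simp add: emeasure_distr)
  let ?X' = "(+) (-y) -` ?X" and ?Y' = "(+) (-x) -` ?Y"
  have [measurable]: "?X' \<in> sets borel" "?Y' \<in> sets borel"
    by (auto intro!: measurable_sets_borel[of _ borel])
  have "emeasure lborel ?X + emeasure lborel ?Y = emeasure lborel ?X' + emeasure lborel ?Y'"
    using translate[of ?X y] translate[of ?Y x] by simp
  also have "\<dots> = emeasure lborel (?X' \<union> ?Y')"
    by (rule plus_emeasure) auto
  also have "\<dots> \<le> emeasure lborel Z"
  proof (intro emeasure_mono subsetI)
    fix z assume "z \<in> ?X' \<union> ?Y'"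
    then show "z \<in> Z"
      using Z(2)[of "z - y" y] Z(2)[of x "z - x"] x y by auto
  qed auto
  finally have 3: "emeasure lborel ?X + emeasure lborel ?Y \<le> emeasure lborel Z" .
  have "emeasure lborel X + emeasure lborel Y
      \<le> (emeasure lborel ?X + ennreal (e / 2)) + (emeasure lborel ?Y + ennreal (e / 2))"
    by (intro add_mono 1 2)
  also have "\<dots> = (emeasure lborel ?X + emeasure lborel ?Y) + ennreal e"
    using \<open>e > 0\<close> by (simp add: ac_simps flip: ennreal_plus)
  also have "\<dots> \<le> emeasure lborel Z + ennreal e"
    using 3 by (intro add_right_mono)
  finally show "emeasure lborel X + emeasure lborel Y \<le> emeasure lborel Z + ennreal e" .
qed

text \<open>By Fubini: for fixed \<open>x\<close> the admissible \<open>s\<close> form the interval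
  from 0 to \<open>min 1 (p x / M)\<close>. The truncation at 1 has no effect when \<open>M\<close>
  bounds \<open>p\<close>.\<close>

lemma nn_integral_superlevel_sets:
  fixes p :: "real \<Rightarrow> real"
  assumes [measurable]: "p \<in> borel_measurable borel" and p: "\<And>x. p x \<ge> 0" and M: "M > 0"
  shows "(\<integral>\<^sup>+s\<in>{0<..<1}. emeasure lborel {x. s * M < p x} \<partial>lborel)
       = (\<integral>\<^sup>+x. ennreal (min 1 (p x / M)) \<partial>lborel)"
proof -
  have "(\<integral>\<^sup>+s\<in>{0<..<1}. emeasure lborel {x. s * M < p x} \<partial>lborel)
      = (\<integral>\<^sup>+s. (\<integral>\<^sup>+x. indicator {(s, x). 0 < s \<and> s < 1 \<and> s * M < p x} (s, x) \<partial>lborel) \<partial>lborel)"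
  proof (rule nn_integral_cong)
    fix s :: real
    have "emeasure lborel {x. s * M < p x} = (\<integral>\<^sup>+x. indicator {x. s * M < p x} x \<partial>lborel)"
      by simp
    then show "emeasure lborel {x. s * M < p x} * indicator {0<..<1} s
        = (\<integral>\<^sup>+x. indicator {(s, x). 0 < s \<and> s < 1 \<and> s * M < p x} (s, x) \<partial>lborel)"
      by (auto simp: indicator_def)
  qed
  also have "\<dots> = (\<integral>\<^sup>+x. (\<integral>\<^sup>+s. indicator {(s, x). 0 < s \<and> s < 1 \<and> s * M < p x} (s, x) \<partial>lborel) \<partial>lborel)"
    by (rule lborel_pair.Fubini') measurable
  also have "\<dots> = (\<integral>\<^sup>+x. ennreal (min 1 (p x / M)) \<partial>lborel)"
  proof (rule nn_integral_cong)
    fix x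
    have "(\<integral>\<^sup>+s. indicator {(s, x). 0 < s \<and> s < 1 \<and> s * M < p x} (s, x) \<partial>lborel)
        = (\<integral>\<^sup>+s. indicator {0<..<min 1 (p x / M)} s \<partial>lborel)"
      using M by (intro nn_integral_cong) (auto simp: indicator_def field_simps)
    also have "\<dots> = ennreal (min 1 (p x / M))"
      using M p[of x] by simp
    finally show "(\<integral>\<^sup>+s. indicator {(s, x). 0 < s \<and> s < 1 \<and> s * M < p x} (s, x) \<partial>lborel)
        = ennreal (min 1 (p x / M))" .
  qed
  finally show ?thesis .
qed

text \<open>Cavalieri's principle. Boundedness of \<open>X\<close> makes the slice lengths finite
  and uniformly bounded, so that \<open>p\<close> is real valued and has a finite supremum.\<close>

lemma slice_measure:
  fixes X :: "(real \<times> real) set"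
  assumes X: "X \<in> sets borel" "bounded X"
    and p_def: "p = (\<lambda>x. measure lborel (Pair x -` X))"
  shows "\<And>x. emeasure lborel (Pair x -` X) = ennreal (p x)"
    and "p \<in> borel_measurable borel"
    and "bdd_above (range p)"
    and "emeasure lborel X = (\<integral>\<^sup>+x. ennreal (p x) \<partial>lborel)"
    and "\<And>x. Pair x -` X \<in> sets borel" "\<And>x. bounded (Pair x -` X)"
proof -
  obtain B where B: "\<And>x. x \<in> X \<Longrightarrow> norm x \<le> B"
    using X(2) bounded_iff by blast
  have slice: "Pair x -` X \<subseteq> cball 0 B" for x
  proof
    fix y assume "y \<in> Pair x -` X"
    then show "y \<in> cball 0 B"
      using B[of "(x, y)"] norm_snd_le[of y x] by auto
  qed
  have Xp: "X \<in> sets (lborel \<Otimes>\<^sub>M lborel)"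
    using X(1) by (simp only: lborel_prod sets_lborel)
  show S: "Pair x -` X \<in> sets borel" for x
    using sets_Pair1[OF Xp] by simp
  show "bounded (Pair x -` X)" for x
    by (rule bounded_subset[OF bounded_cball slice])
  have fin: "emeasure lborel (Pair x -` X) \<le> emeasure lborel (cball (0::real) B)" for x
    using slice by (intro emeasure_mono) auto
  have cb: "emeasure lborel (cball (0::real) B) < \<infinity>"
    by (rule emeasure_lborel_cball_finite)
  show E: "emeasure lborel (Pair x -` X) = ennreal (p x)" for x
    unfolding p_def using fin[of x] cb by (intro emeasure_eq_ennreal_measure) auto
  have "p x \<le> measure lborel (cball (0::real) B)" for x
    using fin[of x] cb unfolding p_def measure_def by (intro enn2real_mono) auto
  then show "bdd_above (range p)"
    by (rule bdd_aboveI2)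
  have "(\<lambda>x. emeasure lborel (Pair x -` X)) \<in> borel_measurable lborel"
    by (rule lborel.measurable_emeasure_Pair[OF Xp])
  from borel_measurable_enn2real[OF this] show "p \<in> borel_measurable borel"
    unfolding p_def measure_def by (simp only: measurable_lborel2 measurable_lborel1)
  show "emeasure lborel X = (\<integral>\<^sup>+x. ennreal (p x) \<partial>lborel)"
    using lborel.emeasure_pair_measure_alt[OF Xp] unfolding lborel_prod E .
qed

text \<open>Slices are compared at equal fractions of their respective suprema, which reduces the
  planar inequality to two applications of the one-dimensional one.\<close>

lemma brunn_minkowski_real_prod:
  fixes X Y Z :: "(real \<times> real) set"
  assumes X: "X \<in> sets borel" "bounded X" "measure lborel X > 0"
    and Y: "Y \<in> sets borel" "bounded Y" "measure lborel Y > 0"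
    and Z: "Z \<in> sets borel" "bounded Z" "\<And>x y. x \<in> X \<Longrightarrow> y \<in> Y \<Longrightarrow> x + y \<in> Z"
  shows "sqrt (measure lborel X) + sqrt (measure lborel Y) \<le> sqrt (measure lborel Z)"
proof -
  define p q r where "p = (\<lambda>x. measure lborel (Pair x -` X))"
    and "q = (\<lambda>x. measure lborel (Pair x -` Y))" and "r = (\<lambda>x. measure lborel (Pair x -` Z))"
  note sX = slice_measure[OF X(1,2) p_def]
  note sY = slice_measure[OF Y(1,2) q_def]
  note sZ = slice_measure[OF Z(1,2) r_def]
  note [measurable] = sX(2) sY(2) sZ(2)
  define M N where "M = (SUP x. p x)" and "N = (SUP x. q x)"
  have pM: "p x \<le> M" "0 \<le> p x" and qN: "q x \<le> N" "0 \<le> q x" and r0: "0 \<le> r x" for x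
    unfolding M_def N_def using sX(3) sY(3)
    by (auto intro!: cSUP_upper2 simp: p_def q_def r_def)
  have pos: "\<exists>x. g x \<noteq> 0" if "emeasure lborel W = (\<integral>\<^sup>+x. ennreal (g x) \<partial>lborel)" "measure lborel W > 0"
    for g and W :: "(real \<times> real) set"
  proof (rule ccontr)
    assume "\<not> ?thesis"
    then have "emeasure lborel W = 0"
      using that(1) by simp
    then show False
      using that(2) by (simp add: measure_def)
  qed
  have "M > 0" "N > 0"
    using pos[OF sX(4) X(3)] pos[OF sY(4) Y(3)] pM qN by (smt (verit))+
  have scaled: "(\<integral>\<^sup>+x. ennreal (g x / K) \<partial>lborel) = ennreal (measure lborel W / K)"
    if "emeasure lborel W = (\<integral>\<^sup>+x. ennreal (g x) \<partial>lborel)" "bounded W" "K > 0"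
       "g \<in> borel_measurable borel" "\<And>x. 0 \<le> g x"
    for g :: "real \<Rightarrow> real" and W :: "(real \<times> real) set" and K
  proof -
    have "(\<integral>\<^sup>+x. ennreal (g x / K) \<partial>lborel) = (\<integral>\<^sup>+x. ennreal (g x) * ennreal (1 / K) \<partial>lborel)"
      using that by (intro nn_integral_cong) (simp flip: ennreal_mult')
    also have "\<dots> = emeasure lborel W * ennreal (1 / K)"
      using that by (simp add: nn_integral_multc)
    also have "emeasure lborel W = ennreal (measure lborel W)"
      using emeasure_bounded_finite[OF that(2)] by (intro emeasure_eq_ennreal_measure) auto
    finally show ?thesis
      using that by (simp flip: ennreal_mult')
  qed
  \<comment> \<open>The inequality on the line is used twice: on two slices, which are nonempty
    because \<open>s * M\<close> and \<open>s * N\<close> are positive, to get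
    \<open>p x + q y \<le> r (x + y)\<close>; and then on the superlevel sets themselves.\<close>
  have level: "emeasure lborel {x. s * M < p x} + emeasure lborel {x. s * N < q x}
      \<le> emeasure lborel {x. s * (M + N) < r x}" if s: "0 < s" "s < 1" for s
  proof (rule brunn_minkowski_real)
    have proj: "bounded {x. s * K < measure lborel (Pair x -` W)}"
      if "bounded W" "K > 0" for W :: "(real \<times> real) set" and K
    proof (rule bounded_subset[OF bounded_fst[OF that(1)]], clarsimp)
      fix x assume "s * K < measure lborel (Pair x -` W)"
      then have "Pair x -` W \<noteq> {}"
        using that s by (metis measure_empty mult_pos_pos not_less_iff_gr_or_eq)
      then show "x \<in> fst ` W" by force
    qed
    show "bounded {x. s * M < p x}" "bounded {x. s * N < q x}"
      using proj[OF X(2) \<open>M > 0\<close>] proj[OF Y(2) \<open>N > 0\<close>] by (simp_all add: p_def q_def)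
    have "s * M < M" "s * N < N"
      using s \<open>M > 0\<close> \<open>N > 0\<close> by auto
    then show "{x. s * M < p x} \<noteq> {}" "{x. s * N < q x} \<noteq> {}"
      using less_cSUP_iff[OF _ sX(3), of "s * M"] less_cSUP_iff[OF _ sY(3), of "s * N"]
      by (auto simp: M_def N_def)
    fix x y assume x: "x \<in> {x. s * M < p x}" and y: "y \<in> {x. s * N < q x}"
    have "0 < s * M" "0 < s * N"
      using s \<open>M > 0\<close> \<open>N > 0\<close> by auto
    then have ne: "Pair x -` X \<noteq> {}" "Pair y -` Y \<noteq> {}"
      using x y by (auto simp: p_def q_def)
    have "emeasure lborel (Pair x -` X) + emeasure lborel (Pair y -` Y)
        \<le> emeasure lborel (Pair (x + y) -` Z)"
      using Z(3) by (intro brunn_minkowski_real ne sX sY sZ) fastforce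
    then have "p x + q y \<le> r (x + y)"
      using pM qN r0 by (simp add: sX(1) sY(1) sZ(1) flip: ennreal_plus)
    then show "x + y \<in> {x. s * (M + N) < r x}"
      using x y by (simp add: algebra_simps)
  qed measurable
  have "ennreal (measure lborel X / M) + ennreal (measure lborel Y / N)
      = (\<integral>\<^sup>+x. ennreal (min 1 (p x / M)) \<partial>lborel) + (\<integral>\<^sup>+x. ennreal (min 1 (q x / N)) \<partial>lborel)"
    using scaled[OF sX(4) X(2) \<open>M > 0\<close> sX(2)] scaled[OF sY(4) Y(2) \<open>N > 0\<close> sY(2)] pM qN \<open>M > 0\<close> \<open>N > 0\<close>
    by (simp add: min_absorb2)
  also have "\<dots> = (\<integral>\<^sup>+s\<in>{0<..<1}. emeasure lborel {x. s * M < p x} \<partial>lborel)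
      + (\<integral>\<^sup>+s\<in>{0<..<1}. emeasure lborel {x. s * N < q x} \<partial>lborel)"
    using pM qN \<open>M > 0\<close> \<open>N > 0\<close> by (simp add: nn_integral_superlevel_sets sX(2) sY(2))
  also have "\<dots> = (\<integral>\<^sup>+s\<in>{0<..<1}. (emeasure lborel {x. s * M < p x} + emeasure lborel {x. s * N < q x}) \<partial>lborel)"
    by (subst nn_integral_add[symmetric]) (auto simp: distrib_right)
  also have "\<dots> \<le> (\<integral>\<^sup>+s\<in>{0<..<1}. emeasure lborel {x. s * (M + N) < r x} \<partial>lborel)"
    using level by (intro nn_integral_mono) (auto simp: indicator_def)
  also have "\<dots> = (\<integral>\<^sup>+x. ennreal (min 1 (r x / (M + N))) \<partial>lborel)"
    using \<open>M > 0\<close> \<open>N > 0\<close> r0 by (intro nn_integral_superlevel_sets) auto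
  \<comment> \<open>For \<open>p\<close> and \<open>q\<close> the truncation was exact;
    \<open>r\<close> may exceed \<open>M + N\<close>, so here it is only an upper bound, in the
    right direction.\<close>
  also have "\<dots> \<le> (\<integral>\<^sup>+x. ennreal (r x / (M + N)) \<partial>lborel)"
    by (intro nn_integral_mono ennreal_leI) auto
  also have "\<dots> = ennreal (measure lborel Z / (M + N))"
    using \<open>M > 0\<close> \<open>N > 0\<close> by (intro scaled sZ Z r0) auto
  finally have "measure lborel X / M + measure lborel Y / N \<le> measure lborel Z / (M + N)"
    using \<open>M > 0\<close> \<open>N > 0\<close> by (simp flip: ennreal_plus)
  then have "(measure lborel X / M + measure lborel Y / N) * (M + N) \<le> measure lborel Z"
    using \<open>M > 0\<close> \<open>N > 0\<close> by (simp add: pos_le_divide_eq)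
  \<comment> \<open>Cauchy--Schwarz with the weights \<open>M\<close> and \<open>N\<close>: the two
    sides differ by an explicit square.\<close>
  moreover have "(sqrt a + sqrt b)\<^sup>2 \<le> (a / M + b / N) * (M + N)" if "a \<ge> 0" "b \<ge> 0" for a b
  proof -
    have "(a / M + b / N) * (M + N) - (sqrt a + sqrt b)\<^sup>2 = (N * sqrt a - M * sqrt b)\<^sup>2 / (M * N)"
      using that \<open>M > 0\<close> \<open>N > 0\<close>
      by (simp add: field_simps power2_eq_square)
    also have "\<dots> \<ge> 0"
      using \<open>M > 0\<close> \<open>N > 0\<close> by simp
    finally show ?thesis by simp
  qed
  ultimately have "(sqrt (measure lborel X) + sqrt (measure lborel Y))\<^sup>2 \<le> measure lborel Z"
    by (meson measure_nonneg order_trans)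
  then show ?thesis
    by (rule real_le_rsqrt)
qed

section \<open>Lebesgue measure on the complex plane and change of variables\<close>

text \<open>The Brunn--Minkowski inequality was obtained on \<open>real \<times> real\<close>, where
  slicing is available; this identification carries it over to \<open>complex\<close>.\<close>

lemma distr_lborel_Complex: "distr lborel borel (\<lambda>(x, y). Complex x y) = lborel"
proof (rule lborel_eqI[symmetric])
  have [measurable]: "(\<lambda>(x, y). Complex x y) \<in> borel_measurable borel"
    unfolding split_beta' by (intro borel_measurable_continuous_onI continuous_intros)
  fix l u :: complex assume le: "\<And>b. b \<in> Basis \<Longrightarrow> l \<bullet> b \<le> u \<bullet> b"
  have eq: "(\<lambda>(x, y). Complex x y) -` box l u = box (Re l, Im l) (Re u, Im u)"
    by (auto simp: box_def Basis_complex_def Basis_prod_def)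
  have le': "Re l \<le> Re u" "Im l \<le> Im u"
    using le[of 1] le[of \<i>] by (auto simp: Basis_complex_def)
  show "emeasure (distr lborel borel (\<lambda>(x, y). Complex x y)) (box l u) = (\<Prod>b\<in>Basis. (u - l) \<bullet> b)"
    using le' by (simp add: emeasure_distr eq emeasure_lborel_box_eq Basis_complex_def Basis_prod_def)
qed simp

text \<open>The change of variables theorem uses determinants on \<open>real^2\<close>, hence this
  second identification.\<close>

lemma distr_lborel_Complex_vec: "distr lborel borel (\<lambda>v::real^2. Complex (v $ 1) (v $ 2)) = lborel"
proof (rule lborel_eqI[symmetric])
  have [measurable]: "(\<lambda>v::real^2. Complex (v $ 1) (v $ 2)) \<in> borel_measurable borel"
    by (intro borel_measurable_continuous_onI continuous_intros)
  fix l u :: complex assume le: "\<And>b. b \<in> Basis \<Longrightarrow> l \<bullet> b \<le> u \<bullet> b"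
  have eq: "(\<lambda>v::real^2. Complex (v $ 1) (v $ 2)) -` box l u
          = box (vector [Re l, Im l]) (vector [Re u, Im u])"
    by (auto simp: mem_box_cart mem_box forall_2 Basis_complex_def vector_2)
  have le': "Re l \<le> Re u" "Im l \<le> Im u"
    using le[of 1] le[of \<i>] by (auto simp: Basis_complex_def)
  have "emeasure lborel (box (vector [Re l, Im l]) (vector [Re u, Im u]) :: (real^2) set)
      = ennreal ((Re u - Re l) * (Im u - Im l))"
    using le'
    by (subst emeasure_lborel_box)
      (auto simp: Basis_vec_def axis_eq_axis inner_axis prod.UNION_disjoint vector_2 UNIV_2 forall_2
        inner_diff_left)
  then show "emeasure (distr lborel borel (\<lambda>v::real^2. Complex (v $ 1) (v $ 2))) (box l u)
      = (\<Prod>b\<in>Basis. (u - l) \<bullet> b)"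
    by (simp add: emeasure_distr eq Basis_complex_def)
qed simp

lemma brunn_minkowski_complex:
  fixes X Y Z :: "complex set"
  assumes X: "X \<in> sets borel" "bounded X" "measure lborel X > 0"
    and Y: "Y \<in> sets borel" "bounded Y" "measure lborel Y > 0"
    and Z: "Z \<in> sets borel" "bounded Z" "\<And>x y. x \<in> X \<Longrightarrow> y \<in> Y \<Longrightarrow> x + y \<in> Z"
  shows "sqrt (measure lborel X) + sqrt (measure lborel Y) \<le> sqrt (measure lborel Z)"
proof -
  let ?T = "\<lambda>(x, y). Complex x y"
  have [measurable]: "?T \<in> borel_measurable borel"
    unfolding split_beta' by (intro borel_measurable_continuous_onI continuous_intros)
  have m: "measure lborel (?T -` W) = measure lborel W" if "W \<in> sets borel" for W
  proof -
    have "measure lborel W = measure (distr lborel borel ?T) W"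
      by (simp only: distr_lborel_Complex)
    then show ?thesis
      using that by (simp add: measure_distr)
  qed
  have b: "?T -` W \<in> sets borel" if "W \<in> sets borel" for W
    using that by (intro measurable_sets_borel[of _ borel]) auto
  have bd: "bounded (?T -` W)" if W: "bounded W" for W
  proof -
    have "?T -` W \<subseteq> (\<lambda>z. (Re z, Im z)) ` W"
      by force
    moreover have "bounded ((\<lambda>z. (Re z, Im z)) ` W)"
      by (intro bounded_linear_image[OF W] bounded_linear_Re bounded_linear_Im bounded_linear_Pair)
    ultimately show ?thesis
      by (rule bounded_subset[rotated])
  qed
  have "sqrt (measure lborel (?T -` X)) + sqrt (measure lborel (?T -` Y)) \<le> sqrt (measure lborel (?T -` Z))"
  proof (rule brunn_minkowski_real_prod)
    fix x y assume "x \<in> ?T -` X" "y \<in> ?T -` Y"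
    then show "x + y \<in> ?T -` Z"
      using Z(3)[of "?T x" "?T y"] by (auto simp: split_beta complex_add)
  qed (use X Y Z in \<open>auto simp: m intro!: b bd\<close>)
  then show ?thesis
    using X Y Z by (simp add: m)
qed

lemma Complex_vec_matrix_det:
  "det (matrix (\<lambda>v::real^2. vector [Re (c * Complex (v $ 1) (v $ 2)), Im (c * Complex (v $ 1) (v $ 2))] :: real^2))
    = (cmod c)\<^sup>2"
  unfolding cmod_power2
  by (simp add: det_2 matrix_def vector_2 axis_def power2_eq_square)

text \<open>Change of variables for \<open>g\<close> read in real coordinates, where the Jacobian
  determinant is the squared modulus of the complex derivative. Boundedness of the image supplies
  the finite measure needed to pass through \<open>has_integral\<close>.\<close>

lemma area_formula_holomorphic:
  fixes g :: "complex \<Rightarrow> complex"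
  assumes g: "g holomorphic_on V" and V: "open V"
    and S: "S \<in> sets borel" "S \<subseteq> V" and gS: "g ` S \<in> sets borel" "bounded (g ` S)"
    and inj: "inj_on g S"
  shows "(\<integral>\<^sup>+x\<in>S. ennreal ((cmod (deriv g x))\<^sup>2) \<partial>lborel) = emeasure lborel (g ` S)"
proof -
  let ?T = "\<lambda>v::real^2. Complex (v $ 1) (v $ 2)"
  let ?R = "\<lambda>z. vector [Re z, Im z] :: real^2"
  have T[measurable]: "?T \<in> borel_measurable borel"
    by (intro borel_measurable_continuous_onI continuous_intros)
  have TR: "?T (?R z) = z" for z by (simp add: vector_2)
  have RT: "?R (?T z) = z" for z by (simp add: vec_eq_iff forall_2 vector_2)
  have linT: "bounded_linear ?T"
    by (rule linear_conv_bounded_linear[THEN iffD1], rule linearI) (auto simp: complex_eq_iff)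
  have linR: "bounded_linear ?R"
    by (rule linear_conv_bounded_linear[THEN iffD1], rule linearI) (auto simp: vec_eq_iff forall_2 vector_2)
  define G where "G = (\<lambda>v. ?R (g (?T v)))"
  define G' where "G' = (\<lambda>x v. ?R (deriv g (?T x) * ?T v))"
  have b: "?T -` W \<in> sets borel" if "W \<in> sets borel" for W
    using that by (intro measurable_sets_borel[of _ borel]) auto
  have im: "G ` (?T -` S) = ?T -` (g ` S)"
  proof (intro equalityI subsetI)
    fix v assume "v \<in> ?T -` g ` S"
    then obtain z where "z \<in> S" "?T v = g z" by auto
    moreover from this have "v = ?R (g z)"
      using RT[of v] by simp
    ultimately show "v \<in> G ` (?T -` S)"
      unfolding G_def by (intro image_eqI[of _ _ "?R z"]) (simp_all only: TR vimage_eq)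
  next
    fix v assume "v \<in> G ` (?T -` S)"
    then obtain w where "v = G w" "?T w \<in> S" by auto
    then show "v \<in> ?T -` g ` S"
      by (simp only: G_def vimage_eq TR) blast
  qed
  have der: "(G has_derivative G' x) (at x within ?T -` S)" if x: "x \<in> ?T -` S" for x
  proof -
    have "(g has_derivative (*) (deriv g (?T x))) (at (?T x))"
      using holomorphic_derivI[OF g V, of "?T x"] S(2) x by (auto simp: has_field_derivative_def)
    then have "((\<lambda>v. g (?T v)) has_derivative (\<lambda>v. deriv g (?T x) * ?T v)) (at x)"
      by (rule has_derivative_compose[OF bounded_linear_imp_has_derivative[OF linT]])
    then show ?thesis
      unfolding G_def G'_def
      by (rule has_derivative_at_withinI[OF bounded_linear.has_derivative[OF linR]])
  qed
  have injG: "inj_on G (?T -` S)"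
  proof (rule inj_onI)
    fix v w assume vw: "v \<in> ?T -` S" "w \<in> ?T -` S" "G v = G w"
    then have "?T (G v) = ?T (G w)"
      by simp
    then have "g (?T v) = g (?T w)"
      by (simp only: G_def TR)
    then have "?T v = ?T w"
      using vw inj by (auto dest: inj_onD)
    then have "?R (?T v) = ?R (?T w)"
      by simp
    then show "v = w"
      by (simp only: RT)
  qed
  have detG: "\<bar>det (matrix (G' x))\<bar> = (cmod (deriv g (?T x)))\<^sup>2" for x
    unfolding G'_def by (subst Complex_vec_matrix_det) simp
  have fin: "emeasure lborel (g ` S) < \<infinity>"
    by (rule emeasure_bounded_finite[OF gS(2)])
  have em: "emeasure lborel (?T -` W) = emeasure lborel W" if "W \<in> sets borel" for W
  proof -
    have "emeasure lborel W = emeasure (distr lborel borel ?T) W"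
      by (simp only: distr_lborel_Complex_vec)
    then show ?thesis
      using that by (simp add: emeasure_distr)
  qed
  have meas: "measure lebesgue (?T -` (g ` S)) = measure lborel (g ` S)"
    using em[OF gS(1)] b[OF gS(1)] by (simp add: measure_def)
  have Sl: "?T -` S \<in> sets lebesgue"
    using b[OF S(1)] by simp
  have "G ` (?T -` S) \<in> lmeasurable \<and> measure lebesgue (G ` (?T -` S)) = measure lborel (g ` S)"
    unfolding im using meas b[OF gS(1)] em[OF gS(1)] fin by (auto simp: fmeasurable_def)
  then have "((\<lambda>x. \<bar>det (matrix (G' x))\<bar>) has_integral measure lborel (g ` S)) (?T -` S)"
    using has_measure_differentiable_image[OF Sl der injG, of "measure lborel (g ` S)"]
    by simp
  then have I: "(\<integral>\<^sup>+x. ennreal ((cmod (deriv g (?T x)))\<^sup>2) * indicator (?T -` S) x \<partial>lborel) = ennreal (measure lborel (g ` S))"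
    unfolding detG by (rule nn_integral_has_integral_lebesgue'[rotated]) simp
  have gm: "(\<lambda>x. ennreal ((cmod (deriv g x))\<^sup>2) * indicator S x) \<in> borel_measurable borel"
  proof -
    have "continuous_on S (\<lambda>x. (cmod (deriv g x))\<^sup>2)"
      by (intro continuous_intros continuous_on_subset[OF _ S(2)] holomorphic_on_imp_continuous_on
          holomorphic_deriv[OF g V])
    then have "(\<lambda>x. indicator S x *\<^sub>R (cmod (deriv g x))\<^sup>2) \<in> borel_measurable borel"
      using S(1) by (intro borel_measurable_continuous_on_indicator) auto
    then have "(\<lambda>x. ennreal (indicator S x *\<^sub>R (cmod (deriv g x))\<^sup>2)) \<in> borel_measurable borel"
      by measurable
    then show ?thesis
      by (rule measurable_cong[THEN iffD1, rotated]) (auto simp: indicator_def)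
  qed
  have "(\<integral>\<^sup>+x\<in>S. ennreal ((cmod (deriv g x))\<^sup>2) \<partial>lborel)
      = (\<integral>\<^sup>+x. ennreal ((cmod (deriv g x))\<^sup>2) * indicator S x \<partial>distr lborel borel ?T)"
    by (simp add: distr_lborel_Complex_vec)
  also have "\<dots> = (\<integral>\<^sup>+x. ennreal ((cmod (deriv g (?T x)))\<^sup>2) * indicator S (?T x) \<partial>lborel)"
    using gm by (intro nn_integral_distr) auto
  also have "\<dots> = emeasure lborel (g ` S)"
    using I fin by (simp add: emeasure_eq_ennreal_measure indicator_def)
  finally show ?thesis .
qed

section \<open>Measurable sections of holomorphic maps\<close>

lemma continuous_on_vimage_borel:
  fixes f :: "complex \<Rightarrow> complex"
  assumes K: "K \<in> sets borel" and f: "continuous_on K f" and R: "R \<in> sets borel"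
  shows "{z \<in> K. f z \<in> R} \<in> sets borel"
proof -
  have "(\<lambda>z. indicator K z *\<^sub>R f z) \<in> borel_measurable borel"
    using borel_measurable_continuous_on_indicator[OF K f] .
  then have "K \<inter> (\<lambda>z. indicator K z *\<^sub>R f z) -` R \<in> sets borel"
    using measurable_sets_borel[OF _ R] K by blast
  moreover have "{z \<in> K. f z \<in> R} = K \<inter> (\<lambda>z. indicator K z *\<^sub>R f z) -` R"
    by auto
  ultimately show ?thesis by simp
qed

text \<open>Finitely many discs on which \<open>f\<close> is injective cover \<open>E\<close>. The
  images of smaller closed discs, made disjoint, cut \<open>R\<close> into Borel pieces
  \<open>P k\<close>, and on \<open>P k\<close> a local inverse \<open>g k\<close> selects the
  preimage, so \<open>m\<close> is \<open>cmod (deriv (g k))\<close> there. By the area formula the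
  integral of \<open>m\<close> squared is the total area of the images of the \<open>P k\<close>
  under \<open>g k\<close>, which are disjoint subsets of \<open>E\<close>.\<close>

lemma measurable_section_derivative:
  fixes f :: "complex \<Rightarrow> complex"
  assumes f: "f holomorphic_on S" "open S" and E: "compact E" "E \<subseteq> S"
    and f': "\<And>z. z \<in> E \<Longrightarrow> deriv f z \<noteq> 0" and R: "R \<in> sets borel" "R \<subseteq> f ` E"
  obtains m :: "complex \<Rightarrow> real" where "m \<in> borel_measurable borel"
    and "\<And>w. w \<in> R \<Longrightarrow> \<exists>z\<in>E. f z = w \<and> m w = 1 / cmod (deriv f z)"
    and "\<And>w. w \<notin> R \<Longrightarrow> m w = 0"
    and "(\<integral>\<^sup>+w. ennreal ((m w)\<^sup>2) \<partial>lborel) \<le> emeasure lborel E"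
proof -
  have "\<exists>r>0. ball z r \<subseteq> S \<and> inj_on f (ball z r)" if "z \<in> E" for z
    using has_complex_derivative_locally_injective[OF f(1) _ f(2) f'[OF that]] E that by blast
  then obtain \<rho> where \<rho>: "\<And>z. z \<in> E \<Longrightarrow> \<rho> z > 0" "\<And>z. z \<in> E \<Longrightarrow> ball z (\<rho> z) \<subseteq> S"
      "\<And>z. z \<in> E \<Longrightarrow> inj_on f (ball z (\<rho> z))"
    by metis
  have "E \<subseteq> (\<Union>z\<in>E. ball z (\<rho> z / 2))"
    using \<rho>(1) by force
  then obtain C where C: "C \<subseteq> E" "finite C" "E \<subseteq> (\<Union>z\<in>C. ball z (\<rho> z / 2))"
    using compactE_image[OF E(1), of E "\<lambda>z. ball z (\<rho> z / 2)"] by auto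
  obtain c and n :: nat where c: "C = c ` {..<n}"
    using finite_imp_nat_seg_image_inj_on[OF C(2)] by (auto simp: lessThan_def)
  have cE: "c k \<in> E" if "k < n" for k
    using that c C(1) by auto
  \<comment> \<open>Injectivity holds on the open disc \<open>B k\<close>; the closed half-size
    discs still cover \<open>E\<close>, and \<open>K k\<close> is compact, so its image is
    Borel.\<close>
  define B where "B k = ball (c k) (\<rho> (c k))" for k
  define K where "K k = E \<inter> cball (c k) (\<rho> (c k) / 2)" for k
  have KB: "K k \<subseteq> B k" and BS: "B k \<subseteq> S" and injB: "inj_on f (B k)" if "k < n" for k
    using \<rho>[OF cE[OF that]] by (auto simp: K_def B_def)
  have KE: "K k \<subseteq> E" for k by (auto simp: K_def)
  have compK: "compact (K k)" for k
    unfolding K_def using E(1) by (intro compact_Int) auto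
  have holB: "f holomorphic_on B k" if "k < n" for k
    using f(1) BS[OF that] holomorphic_on_subset by blast
  have "\<exists>g. g holomorphic_on f ` B k \<and> (\<forall>z\<in>B k. deriv f z * deriv g (f z) = 1) \<and> (\<forall>z\<in>B k. g (f z) = z)"
    if "k < n" for k
    by (rule holomorphic_has_inverse[OF holB[OF that] _ injB[OF that]]) (auto simp: B_def)
  then obtain g where g: "\<And>k. k < n \<Longrightarrow> g k holomorphic_on f ` B k"
      "\<And>k z. k < n \<Longrightarrow> z \<in> B k \<Longrightarrow> deriv f z * deriv (g k) (f z) = 1"
      "\<And>k z. k < n \<Longrightarrow> z \<in> B k \<Longrightarrow> g k (f z) = z"
    by metis
  have oB: "open (f ` B k)" if "k < n" for k
    by (rule open_mapping_thm3[OF holB[OF that] _ injB[OF that]]) (auto simp: B_def)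
  have contE: "continuous_on E f"
    using f(1) E(2) holomorphic_on_imp_continuous_on continuous_on_subset by blast
  have contK: "continuous_on (K k) f" for k
    using continuous_on_subset[OF contE KE] .
  \<comment> \<open>\<open>disjointed\<close> runs over all naturals, while \<open>c k\<close> is
    unspecified for \<open>k \<ge> n\<close>. There \<open>K k\<close> is still compact, and every
    point of \<open>R\<close> already lies in a piece with \<open>k < n\<close>.\<close>
  define P where "P k = R \<inter> disjointed (\<lambda>k. f ` K k) k" for k
  have P[measurable]: "P k \<in> sets borel" for k
  proof -
    have "range (\<lambda>k. f ` K k) \<subseteq> sets borel"
      using compact_imp_closed[OF compact_continuous_image[OF contK compK]] by auto
    then have "range (disjointed (\<lambda>k. f ` K k)) \<subseteq> sets borel"
      using sets.range_disjointed_sets[of _ borel] by simp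
    then show ?thesis
      unfolding P_def using R(1) by blast
  qed
  have Pf: "P k \<subseteq> f ` K k" for k
    using disjointed_subset[of "\<lambda>k. f ` K k" k] by (simp add: P_def le_infI2)
  have PfB: "P k \<subseteq> f ` B k" if "k < n" for k
    using Pf[of k] image_mono[OF KB[OF that], of f] by (rule subset_trans)
  have PR: "P k \<subseteq> R" for k by (auto simp: P_def)
  have Pdisj: "P j \<inter> P k = {}" if "j \<noteq> k" for j k
    using disjoint_family_disjointed[of "\<lambda>k. f ` K k"] that
    by (auto simp: P_def disjoint_family_on_def)
  have RP: "\<exists>k<n. w \<in> P k" if w: "w \<in> R" for w
  proof -
    obtain z where z: "z \<in> E" "f z = w"
      using R(2) w by auto
    then obtain i where i: "i < n" "z \<in> K i"
      using C(3) by (fastforce simp: c K_def)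
    have ex: "w \<in> f ` K i" using i z by auto
    define k where "k = (LEAST k. w \<in> f ` K k)"
    have "w \<in> f ` K k" "k \<le> i" "\<And>j. j < k \<Longrightarrow> w \<notin> f ` K j"
      unfolding k_def using ex by (auto intro: LeastI Least_le dest: not_less_Least)
    then show ?thesis
      using w i by (intro exI[of _ k]) (auto simp: P_def disjointed_def)
  qed
  define t where "t k w = indicator (P k) w *\<^sub>R cmod (deriv (g k) w)" for k w
  define m where "m w = (\<Sum>k<n. t k w)" for w
  have contg: "continuous_on (P k) (\<lambda>w. cmod (deriv (g k) w))" if "k < n" for k
    by (intro continuous_on_norm holomorphic_on_imp_continuous_on
        holomorphic_on_subset[OF holomorphic_deriv[OF g(1)[OF that] oB[OF that]] PfB[OF that]])
  have tm: "t k \<in> borel_measurable borel" if "k < n" for k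
    unfolding t_def using contg[OF that] by (intro borel_measurable_continuous_on_indicator) auto
  have mP: "m w = cmod (deriv (g k) w)" if "w \<in> P k" "k < n" for w k
  proof -
    have "m w = (\<Sum>j<n. if j = k then cmod (deriv (g k) w) else 0)"
      unfolding m_def t_def using that Pdisj by (intro sum.cong) (auto simp: indicator_def)
    then show ?thesis using that by simp
  qed
  \<comment> \<open>Written as a preimage under \<open>f\<close> inside \<open>K k\<close>, this
    image is Borel, and for different \<open>k\<close> the images are disjoint because the
    \<open>P k\<close> are.\<close>
  have gP: "g k ` P k = {z \<in> K k. f z \<in> P k}" if "k < n" for k
  proof (intro equalityI subsetI)
    fix z assume "z \<in> g k ` P k"
    then obtain w where "w \<in> P k" "z = g k w" by auto
    then show "z \<in> {z \<in> K k. f z \<in> P k}"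
      using Pf[of k] g(3)[OF that] KB[OF that] by fastforce
  next
    fix z assume "z \<in> {z \<in> K k. f z \<in> P k}"
    then show "z \<in> g k ` P k"
      using g(3)[OF that] KB[OF that] by (intro image_eqI[of _ _ "f z"]) auto
  qed
  have gPm: "g k ` P k \<in> sets borel" if "k < n" for k
    unfolding gP[OF that] using compact_imp_closed[OF compK]
    by (intro continuous_on_vimage_borel contK P) auto
  show ?thesis
  proof
    show "m \<in> borel_measurable borel"
      unfolding m_def using tm by (intro borel_measurable_sum) auto
    show "m w = 0" if "w \<notin> R" for w
      unfolding m_def t_def using that PR by (intro sum.neutral) (auto simp: indicator_def)
    show "\<exists>z\<in>E. f z = w \<and> m w = 1 / cmod (deriv f z)" if w: "w \<in> R" for w
    proof -
      obtain k where k: "k < n" "w \<in> P k"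
        using RP[OF w] by auto
      then obtain z where z: "z \<in> K k" "f z = w"
        using Pf[of k] by (auto simp: subset_iff image_iff)
      have "deriv f z * deriv (g k) w = 1"
        using g(2)[OF k(1)] KB[OF k(1)] z by auto
      then have "cmod (deriv f z) * cmod (deriv (g k) w) = 1"
        by (metis norm_mult norm_one)
      then have "m w = 1 / cmod (deriv f z)"
        using mP[OF k(2,1)] by (metis eq_divide_imp mult.commute mult_zero_left zero_neq_one)
      then show ?thesis
        using z KE by blast
    qed
    have "(\<integral>\<^sup>+w. ennreal ((m w)\<^sup>2) \<partial>lborel)
        = (\<integral>\<^sup>+w. (\<Sum>k<n. ennreal ((cmod (deriv (g k) w))\<^sup>2) * indicator (P k) w) \<partial>lborel)"
    proof (rule nn_integral_cong)
      fix w
      show "ennreal ((m w)\<^sup>2) = (\<Sum>k<n. ennreal ((cmod (deriv (g k) w))\<^sup>2) * indicator (P k) w)"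
      proof (cases "\<exists>k<n. w \<in> P k")
        case True
        then obtain k where k: "k < n" "w \<in> P k" by auto
        have "(\<Sum>j<n. ennreal ((cmod (deriv (g j) w))\<^sup>2) * indicator (P j) w)
            = (\<Sum>j<n. if j = k then ennreal ((cmod (deriv (g k) w))\<^sup>2) else 0)"
          using k Pdisj by (intro sum.cong) (auto simp: indicator_def)
        then show ?thesis
          using k by (simp add: mP)
      next
        case False
        then show ?thesis
          by (auto simp: m_def t_def indicator_def)
      qed
    qed
    also have "\<dots> = (\<Sum>k<n. \<integral>\<^sup>+w\<in>P k. ennreal ((cmod (deriv (g k) w))\<^sup>2) \<partial>lborel)"
    proof (rule nn_integral_sum)
      fix k assume k: "k \<in> {..<n}"
      have "(\<lambda>w. ennreal ((t k w)\<^sup>2)) \<in> borel_measurable borel"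
        using tm[of k] k by auto
      moreover have "(\<lambda>w. ennreal ((t k w)\<^sup>2)) = (\<lambda>w. ennreal ((cmod (deriv (g k) w))\<^sup>2) * indicator (P k) w)"
        by (auto simp: t_def indicator_def)
      ultimately show "(\<lambda>w. ennreal ((cmod (deriv (g k) w))\<^sup>2) * indicator (P k) w) \<in> borel_measurable lborel"
        by simp
    qed
    also have "\<dots> = (\<Sum>k<n. emeasure lborel (g k ` P k))"
    proof (intro sum.cong refl area_formula_holomorphic)
      fix k assume "k \<in> {..<n}"
      then have k: "k < n" by simp
      show "g k holomorphic_on f ` B k" "open (f ` B k)" "g k ` P k \<in> sets borel"
        using k g oB gPm by auto
      show "P k \<subseteq> f ` B k"
        using PfB[OF k] .
      show "bounded (g k ` P k)"
        unfolding gP[OF k] using compact_imp_bounded[OF compK] by (rule bounded_subset) auto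
      show "inj_on (g k) (P k)"
      proof (rule inj_onI)
        fix v w assume "v \<in> P k" "w \<in> P k" and eq: "g k v = g k w"
        then have "v \<in> f ` B k" "w \<in> f ` B k"
          using PfB[OF k] by (auto dest: subsetD)
        then obtain x y where "x \<in> B k" "v = f x" "y \<in> B k" "w = f y"
          by (elim imageE)
        then show "v = w"
          using eq g(3)[OF k] by auto
      qed
    qed auto
    also have "\<dots> = emeasure lborel (\<Union>k<n. g k ` P k)"
    proof (rule sum_emeasure)
      show "disjoint_family_on (\<lambda>k. g k ` P k) {..<n}"
        unfolding disjoint_family_on_def
      proof (intro ballI impI)
        fix j k assume jk: "j \<in> {..<n}" "k \<in> {..<n}" "j \<noteq> k"
        then show "g j ` P j \<inter> g k ` P k = {}"
          using Pdisj[OF jk(3)] by (auto simp: gP)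
      qed
    qed (use gPm in auto)
    also have "\<dots> \<le> emeasure lborel E"
      using gP KE compact_imp_closed[OF E(1)] by (intro emeasure_mono) auto
    finally show "(\<integral>\<^sup>+w. ennreal ((m w)\<^sup>2) \<partial>lborel) \<le> emeasure lborel E" .
  qed
qed

section \<open>Lipschitz estimates for local inverses\<close>

text \<open>By continuity and the strict inequality, an inverse branch has derivative of modulus
  below \<open>L\<close> on a small disc around \<open>f z0\<close>; the mean value inequality on
  this convex set does the rest. That \<open>L\<close> may be arbitrarily close to
  \<open>1 / cmod (deriv f z0)\<close> is what makes the limit in
  \<open>limsup_layer_slice_le\<close> sharp.\<close>

lemma local_inverse_lipschitz:
  fixes f :: "complex \<Rightarrow> complex"
  assumes f: "f holomorphic_on S" "open S" and z0: "z0 \<in> S" "deriv f z0 \<noteq> 0"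
    and L: "1 / cmod (deriv f z0) < L"
  obtains N d where "open N" "z0 \<in> N" "d > 0"
    "\<And>z y. z \<in> N \<Longrightarrow> dist y (f z) < d \<Longrightarrow> \<exists>z'\<in>S. f z' = y \<and> dist z' z \<le> L * dist y (f z)"
proof -
  obtain r where r: "r > 0" "ball z0 r \<subseteq> S" "inj_on f (ball z0 r)" "open (f ` ball z0 r)"
    using has_complex_derivative_locally_invertible[OF f(1) z0(1) f(2) z0(2)] by metis
  define V where "V = f ` ball z0 r"
  have holB: "f holomorphic_on ball z0 r"
    using f(1) r(2) holomorphic_on_subset by blast
  obtain g where g: "g holomorphic_on V" "\<And>z. z \<in> ball z0 r \<Longrightarrow> deriv f z * deriv g (f z) = 1"
      "\<And>z. z \<in> ball z0 r \<Longrightarrow> g (f z) = z"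
    using holomorphic_has_inverse[OF holB _ r(3)] unfolding V_def by auto
  have "open V" "f z0 \<in> V"
    using r by (auto simp: V_def)
  have "deriv f z0 * deriv g (f z0) = 1"
    using g(2) r(1) by simp
  then have "cmod (deriv f z0) * cmod (deriv g (f z0)) = 1"
    by (metis norm_mult norm_one)
  then have "cmod (deriv g (f z0)) < L"
    using L z0(2) by (metis eq_divide_imp mult.commute mult_zero_left zero_neq_one)
  define W where "W = {w \<in> V. cmod (deriv g w) < L}"
  have "continuous_on V (\<lambda>w. cmod (deriv g w))"
    using holomorphic_on_imp_continuous_on[OF holomorphic_deriv[OF g(1) \<open>open V\<close>]]
    by (intro continuous_intros)
  then have "open W"
    using continuous_open_preimage[OF _ \<open>open V\<close> open_lessThan[of L]]
    by (auto simp: W_def vimage_def Int_def)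
  moreover have "f z0 \<in> W"
    using \<open>cmod (deriv g (f z0)) < L\<close> \<open>f z0 \<in> V\<close> by (simp add: W_def)
  ultimately obtain e where e: "e > 0" "ball (f z0) e \<subseteq> W"
    by (meson openE)
  \<comment> \<open>Halving the radius keeps \<open>f z\<close>, and each \<open>y\<close> within
    \<open>e / 2\<close> of it, in the disc of radius \<open>e\<close>.\<close>
  define N where "N = {z \<in> ball z0 r. f z \<in> ball (f z0) (e / 2)}"
  show ?thesis
  proof
    show "open N"
      using continuous_open_preimage[OF holomorphic_on_imp_continuous_on[OF holB] open_ball
          open_ball[of "f z0" "e / 2"]]
      by (auto simp: N_def vimage_def Int_def)
    show "z0 \<in> N" "e / 2 > 0"
      using r(1) e(1) by (auto simp: N_def)
    fix z y assume z: "z \<in> N" and y: "dist y (f z) < e / 2"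
    have zB: "z \<in> ball z0 r" and "dist (f z0) (f z) < e / 2"
      using z by (auto simp: N_def)
    then have fz: "f z \<in> ball (f z0) e" "y \<in> ball (f z0) e"
      using y e(1) dist_triangle[of "f z0" y "f z"] by (auto simp: dist_commute)
    have "cmod (g y - g (f z)) \<le> L * cmod (y - f z)"
    proof (rule field_differentiable_bound[OF convex_ball _ _ fz(2,1)])
      fix w assume "w \<in> ball (f z0) e"
      then have w: "w \<in> V" "cmod (deriv g w) < L"
        using e(2) by (auto simp: W_def)
      show "(g has_field_derivative deriv g w) (at w within ball (f z0) e)"
        using holomorphic_derivI[OF g(1) \<open>open V\<close> w(1)] .
      show "cmod (deriv g w) \<le> L"
        using w(2) by simp
    qed
    moreover obtain z' where z': "z' \<in> ball z0 r" "y = f z'"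
      using fz(2) e(2) by (auto simp: W_def V_def)
    ultimately have "dist z' z \<le> L * dist y (f z)"
      using g(3) zB by (simp add: dist_norm)
    then show "\<exists>z'\<in>S. f z' = y \<and> dist z' z \<le> L * dist y (f z)"
      using z' r(2) by blast
  qed
qed

text \<open>Compactness makes the constants uniform in \<open>z\<close>. This \<open>L\<close> is
  not sharp; it serves to dominate an integrand.\<close>

lemma uniform_local_inverse_lipschitz:
  fixes f :: "complex \<Rightarrow> complex"
  assumes f: "f holomorphic_on S" "open S" and E: "compact E" "E \<subseteq> S"
    and f': "\<And>z. z \<in> E \<Longrightarrow> deriv f z \<noteq> 0"
  obtains L d where "L > 0" "d > 0"
    "\<And>z y. z \<in> E \<Longrightarrow> dist y (f z) < d \<Longrightarrow> \<exists>z'\<in>S. f z' = y \<and> dist z' z \<le> L * dist y (f z)"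
proof -
  have "\<exists>N d. open N \<and> z0 \<in> N \<and> d > 0 \<and> (\<forall>z\<in>N. \<forall>y. dist y (f z) < d \<longrightarrow>
      (\<exists>z'\<in>S. f z' = y \<and> dist z' z \<le> (1 / cmod (deriv f z0) + 1) * dist y (f z)))" if "z0 \<in> E" for z0
    using local_inverse_lipschitz[OF f, of z0 "1 / cmod (deriv f z0) + 1"] f'[OF that] E that
    by (smt (verit, best) subset_iff)
  then obtain N d where N: "\<And>z0. z0 \<in> E \<Longrightarrow> open (N z0)" "\<And>z0. z0 \<in> E \<Longrightarrow> z0 \<in> N z0"
    and d: "\<And>z0. z0 \<in> E \<Longrightarrow> d z0 > 0"
    and inv: "\<And>z0 z y. z0 \<in> E \<Longrightarrow> z \<in> N z0 \<Longrightarrow> dist y (f z) < d z0 \<Longrightarrow>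
      \<exists>z'\<in>S. f z' = y \<and> dist z' z \<le> (1 / cmod (deriv f z0) + 1) * dist y (f z)"
    by metis
  obtain C where C: "C \<subseteq> E" "finite C" "E \<subseteq> (\<Union>z\<in>C. N z)"
    using compactE_image[OF E(1), of E N] N by blast
  define L where "L = Max (insert 1 ((\<lambda>z. 1 / cmod (deriv f z) + 1) ` C))"
  define \<delta> where "\<delta> = Min (insert 1 (d ` C))"
  show ?thesis
  proof
    show "L > 0"
      unfolding L_def using C(2) by (intro less_le_trans[OF zero_less_one Max_ge]) auto
    show "\<delta> > 0"
      using C d by (auto simp: \<delta>_def)
    fix z y assume z: "z \<in> E" and y: "dist y (f z) < \<delta>"
    obtain c where c: "c \<in> C" "z \<in> N c"
      using C(3) z by blast
    then have "\<delta> \<le> d c" "1 / cmod (deriv f c) + 1 \<le> L"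
      using C(2) by (auto simp: \<delta>_def L_def)
    moreover from this obtain z' where "z' \<in> S" "f z' = y" "dist z' z \<le> (1 / cmod (deriv f c) + 1) * dist y (f z)"
      using inv[of c z y] c C(1) y by force
    ultimately show "\<exists>z'\<in>S. f z' = y \<and> dist z' z \<le> L * dist y (f z)"
      using mult_right_mono[of "1 / cmod (deriv f c) + 1" L "dist y (f z)"]
      by (intro bexI[of _ z']) auto
  qed
qed

section \<open>Erosion of open sets\<close>

text \<open>A compact ball inside \<open>U\<close> has a positive margin \<open>e\<close>, and a
  ball with centre closer than \<open>e\<close> is a translate within this margin.\<close>

lemma open_erosion:
  fixes U :: "'a::euclidean_space set"
  assumes "open U"
  shows "open {x. cball x \<delta> \<subseteq> U}"
proof (rule openI)
  fix x assume "x \<in> {x. cball x \<delta> \<subseteq> U}"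
  then obtain e where e: "e > 0" "(\<Union>y\<in>cball x \<delta>. cball y e) \<subseteq> U"
    using compact_subset_open_imp_cball_epsilon_subset[of "cball x \<delta>" U] assms by auto
  have "cball x' \<delta> \<subseteq> U" if x': "x' \<in> ball x e" for x'
  proof
    fix y assume "y \<in> cball x' \<delta>"
    then have "y - (x' - x) \<in> cball x \<delta>" "y \<in> cball (y - (x' - x)) e"
      using x' by (auto simp: dist_norm algebra_simps norm_minus_commute)
    then show "y \<in> U"
      using e(2) by blast
  qed
  then show "\<exists>e>0. ball x e \<subseteq> {x. cball x \<delta> \<subseteq> U}"
    using e(1) by blast
qed

text \<open>The sum of the erosion and a disc of radius \<open>\<delta>\<close> lies in
  \<open>U\<close>. Brunn--Minkowski bounds \<open>sqrt\<close> of the area of \<open>U\<close>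
  below by \<open>sqrt\<close> of the area of the erosion plus \<open>sqrt pi * \<delta>\<close>;
  squaring and dropping the term \<open>pi * \<delta>^2\<close> gives the claim. If the erosion is
  null, the claim is trivial.\<close>

lemma measure_erosion_le:
  fixes U :: "complex set"
  assumes U: "open U" "bounded U" and \<delta>: "\<delta> > 0"
  shows "measure lborel {x. cball x \<delta> \<subseteq> U} + 2 * sqrt pi * \<delta> * sqrt (measure lborel {x. cball x \<delta> \<subseteq> U})
    \<le> measure lborel U"
proof -
  let ?X = "{x. cball x \<delta> \<subseteq> U}"
  have sub: "?X \<subseteq> U"
    using \<delta> by force
  have X: "?X \<in> sets borel" "bounded ?X" and Ub: "U \<in> sets borel"
    using open_erosion[OF U(1)] bounded_subset[OF U(2) sub] U(1) by auto
  show ?thesis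
  proof (cases "measure lborel ?X > 0")
    case True
    have ball: "measure lborel (ball (0::complex) \<delta>) = pi * \<delta>\<^sup>2"
      using \<delta> by (simp add: content_ball unit_ball_vol_2 DIM_complex)
    have "sqrt (measure lborel ?X) + sqrt (measure lborel (ball (0::complex) \<delta>)) \<le> sqrt (measure lborel U)"
    proof (rule brunn_minkowski_complex[OF X True _ _ _ Ub U(2)])
      fix x y :: complex assume "x \<in> ?X" "y \<in> ball 0 \<delta>"
      moreover from this have "x + y \<in> cball x \<delta>"
        by (simp add: dist_norm)
      ultimately show "x + y \<in> U" by blast
    qed (use \<delta> ball in auto)
    then have "(sqrt (measure lborel ?X) + sqrt pi * \<delta>)\<^sup>2 \<le> (sqrt (measure lborel U))\<^sup>2"
      using \<delta> by (intro power_mono) (auto simp: ball real_sqrt_mult)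
    then have "measure lborel ?X + 2 * sqrt (measure lborel ?X) * (sqrt pi * \<delta>) + (sqrt pi * \<delta>)\<^sup>2 \<le> measure lborel U"
      by (simp add: power2_sum)
    moreover have "(sqrt pi * \<delta>)\<^sup>2 \<ge> 0" by simp
    ultimately have "measure lborel ?X + 2 * sqrt (measure lborel ?X) * (sqrt pi * \<delta>) \<le> measure lborel U"
      by linarith
    then show ?thesis
      by (simp add: mult_ac)
  next
    case False
    then have "measure lborel ?X = 0"
      by (simp add: not_less measure_le_0_iff)
    then show ?thesis by simp
  qed
qed

section \<open>Annuli without critical points\<close>

text \<open>Critical points are excluded on the closed annulus only. They may occur where
  \<open>cmod z < a\<close>, although \<open>U t\<close> is the image of the full disc.\<close>

locale regular_annulus =
  fixes f :: "complex \<Rightarrow> complex" and a b :: real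
  assumes hol: "f holomorphic_on ball 0 1"
    and ab: "0 < a" "a < b" "b < 1"
    and deriv_nz: "\<And>z. a \<le> cmod z \<Longrightarrow> cmod z \<le> b \<Longrightarrow> deriv f z \<noteq> 0"
begin

abbreviation U where "U t \<equiv> f ` ball 0 t"

definition A where "A t = measure lborel (U t)"

lemma U_mono: "s \<le> t \<Longrightarrow> U s \<subseteq> U t"
  by (intro image_mono) auto

lemma cont: "t < 1 \<Longrightarrow> continuous_on (cball 0 t) f"
  by (rule continuous_on_subset[OF holomorphic_on_imp_continuous_on[OF hol]]) auto

lemma open_U: "t \<le> 1 \<Longrightarrow> open (U t)"
proof -
  assume t: "t \<le> 1"
  have "\<not> f constant_on ball 0 1"
  proof
    assume "f constant_on ball 0 1"
    then obtain c where c: "\<And>z. z \<in> ball 0 1 \<Longrightarrow> f z = c"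
      by (auto simp: constant_on_def)
    have "deriv f (of_real a) = deriv (\<lambda>_. c) (of_real a)"
      by (rule complex_derivative_transform_within_open[OF hol _ open_ball]) (use ab c in auto)
    then show False
      using deriv_nz[of "of_real a"] ab by simp
  qed
  then show ?thesis
    using t by (intro open_mapping_thm[OF hol]) auto
qed

lemma U_sets [measurable]: "t \<le> 1 \<Longrightarrow> U t \<in> sets borel"
  using open_U by auto

lemma bounded_U: "t < 1 \<Longrightarrow> bounded (U t)"
proof -
  assume t: "t < 1"
  have "bounded (f ` cball 0 t)"
    by (intro compact_imp_bounded compact_continuous_image cont t compact_cball)
  then show ?thesis
    by (rule bounded_subset) auto
qed

lemma emeasure_U: "t < 1 \<Longrightarrow> emeasure lborel (U t) = ennreal (A t)"
  unfolding A_def using emeasure_bounded_finite[OF bounded_U, of t]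
  by (intro emeasure_eq_ennreal_measure) auto

lemma A_mono: "s \<le> t \<Longrightarrow> t < 1 \<Longrightarrow> A s \<le> A t"
  using emeasure_mono[OF U_mono, of s t lborel] emeasure_U[of s] emeasure_U[of t]
  by (simp add: A_def)

lemma A_nonneg: "A t \<ge> 0"
  by (simp add: A_def)

lemma emeasure_U_diff: "s \<le> t \<Longrightarrow> t < 1 \<Longrightarrow> emeasure lborel (U t - U s) = ennreal (A t - A s)"
  using A_mono[of s t] by (subst emeasure_Diff) (auto simp: emeasure_U U_mono ennreal_minus A_nonneg)

text \<open>The modulus attains its minimum on the compact fibre of \<open>w\<close> in
  \<open>cball 0 b\<close>. As \<open>w\<close> avoids \<open>U a\<close>, the minimizer lies in the
  annulus; \<open>w \<notin> U (cmod z)\<close> records its minimality.\<close>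

lemma exists_minimal_preimage:
  assumes w: "w \<in> U b - U a"
  obtains z where "a \<le> cmod z" "cmod z \<le> b" "f z = w" "w \<notin> U (cmod z)"
proof -
  define Z where "Z = {z \<in> cball 0 b. f z = w}"
  have "Z = cball 0 b \<inter> f -` {w}"
    by (auto simp: Z_def)
  moreover have "closed (cball 0 b \<inter> f -` {w})"
    by (intro continuous_closed_preimage cont ab) auto
  ultimately have "compact Z"
    by (simp add: Z_def compact_eq_bounded_closed bounded_subset[OF bounded_cball[of 0 b]])
  moreover have "Z \<noteq> {}"
    using w by (force simp: Z_def)
  ultimately obtain z where z: "z \<in> Z" "\<And>y. y \<in> Z \<Longrightarrow> cmod z \<le> cmod y"
    using continuous_attains_inf[of Z cmod] by (auto intro: continuous_intros)
  show ?thesis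
  proof
    show "cmod z \<le> b" "f z = w"
      using z(1) by (auto simp: Z_def)
    then show "a \<le> cmod z"
      using w by (intro leI notI) auto
    show "w \<notin> U (cmod z)"
    proof
      assume "w \<in> U (cmod z)"
      then obtain y where "cmod y < cmod z" "f y = w" by auto
      then show False
        using z(2)[of y] \<open>cmod z \<le> b\<close> by (auto simp: Z_def)
    qed
  qed
qed

text \<open>\<open>m\<close> stands in for the gradient length of the least preimage modulus.
  Several preimages may share that modulus, and any one of them may be chosen, hence the existential
  form. Off \<open>U b - U a\<close> only the sign is prescribed.\<close>

definition minimal_slope where
  "minimal_slope m \<longleftrightarrow> m \<in> borel_measurable borel \<and> (\<forall>w. 0 \<le> m w) \<and> (\<forall>w\<in>U b - U a.
    \<exists>z. a \<le> cmod z \<and> cmod z \<le> b \<and> f z = w \<and> w \<notin> U (cmod z) \<and> m w = 1 / cmod (deriv f z))"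

lemma minimal_slopeD:
  assumes "minimal_slope m"
  shows "m \<in> borel_measurable borel" "\<And>w. 0 \<le> m w"
    and "\<And>w. w \<in> U b - U a \<Longrightarrow>
      \<exists>z. a \<le> cmod z \<and> cmod z \<le> b \<and> f z = w \<and> w \<notin> U (cmod z) \<and> m w = 1 / cmod (deriv f z)"
  using assms by (simp_all only: minimal_slope_def)

text \<open>The preimages of least modulus in the annulus form a compact set \<open>E\<close> whose
  image covers \<open>U b - U a\<close>. The slope of a measurable section into \<open>E\<close> has
  square integral at most the area of \<open>E\<close>, hence at most that of the annulus.\<close>

lemma exists_minimal_slope:
  "\<exists>m. minimal_slope m \<and> (\<integral>\<^sup>+w. ennreal ((m w)\<^sup>2) \<partial>lborel) \<le> ennreal (pi * (b\<^sup>2 - a\<^sup>2))"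
proof -
  \<comment> \<open>For \<open>cmod z \<le> b\<close>, membership in \<open>O'\<close> means that
    \<open>f z\<close> also has a preimage of smaller modulus. The intermediate radius
    \<open>q\<close> shows that this set is open, so that \<open>E\<close> is compact.\<close>
  define O' where "O' = (\<Union>q\<in>{..1}. {z \<in> ball 0 1. f z \<in> U q} \<inter> {z. q < cmod z})"
  define E where "E = (cball 0 b - ball 0 a) - O'"
  have "open {z \<in> ball 0 1. f z \<in> U q}" if "q \<le> 1" for q
    using continuous_open_preimage[OF holomorphic_on_imp_continuous_on[OF hol] open_ball open_U[OF that]]
    by (auto simp: vimage_def Int_def)
  moreover have "open {z. q < cmod z}" for q
    by (intro open_Collect_less continuous_intros)
  ultimately have "open O'"
    unfolding O'_def by blast
  then have "compact E"
    unfolding E_def by (intro compact_diff) auto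
  have E_iff: "z \<in> E \<longleftrightarrow> a \<le> cmod z \<and> cmod z \<le> b \<and> f z \<notin> U (cmod z)" for z
  proof -
    have "z \<in> O' \<longleftrightarrow> f z \<in> U (cmod z)" if z: "cmod z \<le> b"
    proof
      assume "z \<in> O'"
      then show "f z \<in> U (cmod z)"
        using U_mono[of _ "cmod z"] by (fastforce simp: O'_def)
    next
      assume "f z \<in> U (cmod z)"
      then obtain y where y: "cmod y < cmod z" "f z = f y" by auto
      then obtain q where "cmod y < q" "q < cmod z"
        using dense by blast
      with y show "z \<in> O'"
        using z ab by (auto simp: O'_def intro!: bexI[of _ q])
    qed
    then show ?thesis
      by (auto simp: E_def)
  qed
  have RE: "U b - U a \<subseteq> f ` E"
  proof
    fix w assume "w \<in> U b - U a"
    then obtain z where "a \<le> cmod z" "cmod z \<le> b" "f z = w" "w \<notin> U (cmod z)"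
      by (rule exists_minimal_preimage)
    then show "w \<in> f ` E"
      using E_iff[of z] by (intro image_eqI[of _ _ z]) simp_all
  qed
  have E: "E \<subseteq> ball 0 1" "\<And>z. z \<in> E \<Longrightarrow> deriv f z \<noteq> 0"
    using ab deriv_nz by (auto simp: E_iff)
  have "U b - U a \<in> sets borel"
    using ab by auto
  obtain m where m: "m \<in> borel_measurable borel"
    "\<And>w. w \<in> U b - U a \<Longrightarrow> \<exists>z\<in>E. f z = w \<and> m w = 1 / cmod (deriv f z)"
    "\<And>w. w \<notin> U b - U a \<Longrightarrow> m w = 0"
    "(\<integral>\<^sup>+w. ennreal ((m w)\<^sup>2) \<partial>lborel) \<le> emeasure lborel E"
    by (rule measurable_section_derivative[OF hol open_ball \<open>compact E\<close> E \<open>U b - U a \<in> sets borel\<close> RE])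
      (assumption, rule that, auto)
  have "emeasure lborel E \<le> emeasure lborel (cball (0::complex) b - ball 0 a)"
    by (intro emeasure_mono) (auto simp: E_def)
  also have "\<dots> = emeasure lborel (cball (0::complex) b) - emeasure lborel (ball (0::complex) a)"
    using ab emeasure_lborel_ball_finite[of "0::complex" a] by (intro emeasure_Diff) auto
  also have "\<dots> = ennreal (pi * b\<^sup>2) - ennreal (pi * a\<^sup>2)"
    using ab by (simp add: emeasure_cball emeasure_ball unit_ball_vol_2)
  also have "\<dots> = ennreal (pi * (b\<^sup>2 - a\<^sup>2))"
    by (subst ennreal_minus) (auto simp: algebra_simps)
  finally have area: "emeasure lborel E \<le> ennreal (pi * (b\<^sup>2 - a\<^sup>2))" .
  have "minimal_slope m"
    unfolding minimal_slope_def
  proof (intro conjI allI ballI)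
    show "m \<in> borel_measurable borel" by fact
    show "0 \<le> m w" for w
      using m(2,3)[of w] by (cases "w \<in> U b - U a") auto
    show "\<exists>z. a \<le> cmod z \<and> cmod z \<le> b \<and> f z = w \<and> w \<notin> U (cmod z) \<and> m w = 1 / cmod (deriv f z)"
      if w: "w \<in> U b - U a" for w
    proof -
      obtain z where "z \<in> E" "f z = w" "m w = 1 / cmod (deriv f z)"
        using m(2)[OF w] by auto
      then show ?thesis
        using E_iff[of z] by (intro exI[of _ z]) simp
    qed
  qed
  then show ?thesis
    using order_trans[OF m(4) area] by (intro exI[of _ m] conjI)
qed

end

section \<open>Boundary layers and the slope inequality\<close>

text \<open>Left continuity in \<open>r\<close> turns the set into a countable union of rectangles
  indexed by rational \<open>q\<close>.\<close>

lemma left_continuous_family_sets: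
  fixes S :: "real \<Rightarrow> 'a::euclidean_space set"
  assumes S: "\<And>q. q < t \<Longrightarrow> S q \<in> sets borel"
    and lc: "\<And>x r. r < t \<Longrightarrow> x \<in> S r \<longleftrightarrow> (\<exists>q\<in>\<rat>. q < r \<and> x \<in> S q)"
  shows "{(x, r). s < r \<and> r < t \<and> x \<in> S r} \<in> sets (lborel \<Otimes>\<^sub>M lborel)"
proof -
  have "{(x, r). s < r \<and> r < t \<and> x \<in> S r} = (\<Union>q\<in>\<rat> \<inter> {..<t}. S q \<times> ({q<..} \<inter> {s<..<t}))"
    (is "?L = ?R")
  proof (rule set_eqI, unfold split_paired_all)
    fix x r
    show "(x, r) \<in> ?L \<longleftrightarrow> (x, r) \<in> ?R"
    proof (cases "r < t")
      case True
      have "(x, r) \<in> ?L \<longleftrightarrow> s < r \<and> x \<in> S r"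
        using True by simp
      also have "\<dots> \<longleftrightarrow> s < r \<and> (\<exists>q\<in>\<rat>. q < r \<and> x \<in> S q)"
        by (simp only: lc[OF True])
      also have "\<dots> \<longleftrightarrow> (x, r) \<in> ?R"
        using True by auto
      finally show ?thesis .
    qed simp
  qed
  moreover have "countable (\<rat> \<inter> {..<t})"
    by (rule countable_subset[OF _ countable_rat]) auto
  moreover have "S q \<times> ({q<..} \<inter> {s<..<t}) \<in> sets (lborel \<Otimes>\<^sub>M lborel)" if "q < t" for q
    using S[OF that] by (intro pair_measureI) auto
  ultimately show ?thesis
    by auto
qed

context regular_annulus
begin

text \<open>For fixed \<open>r\<close> this is the inner boundary strip of \<open>U r\<close> of
  width \<open>\<delta>\<close>. Keeping \<open>x\<close> and \<open>r\<close> together permits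
  integration in either order.\<close>

definition layer where
  "layer \<delta> s t = {(x, r). s < r \<and> r < t \<and> x \<in> U r \<and> \<not> cball x \<delta> \<subseteq> U r}"

text \<open>Both \<open>U r\<close> and its erosion are left continuous in \<open>r\<close>. For the
  erosion this uses compactness of the closed disc: finitely many of the nested sets
  \<open>U q\<close> with rational \<open>q < r\<close> cover it, and the largest one contains
  it.\<close>

lemma layer_sets:
  assumes "t \<le> 1"
  shows "layer \<delta> s t \<in> sets (lborel \<Otimes>\<^sub>M lborel)"
proof -
  have 1: "x \<in> U r \<longleftrightarrow> (\<exists>q\<in>\<rat>. q < r \<and> x \<in> U q)" for x r
  proof
    assume "x \<in> U r"
    then obtain z where z: "cmod z < r" "x = f z" by auto
    then obtain q where "q \<in> \<rat>" "cmod z < q" "q < r"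
      using Rats_dense_in_real by blast
    then show "\<exists>q\<in>\<rat>. q < r \<and> x \<in> U q"
      using z by (intro bexI[of _ q]) auto
  next
    assume "\<exists>q\<in>\<rat>. q < r \<and> x \<in> U q"
    then show "x \<in> U r" using U_mono[of _ r] by fastforce
  qed
  have 2: "x \<in> {x. cball x \<delta> \<subseteq> U r} \<longleftrightarrow> (\<exists>q\<in>\<rat>. q < r \<and> x \<in> {x. cball x \<delta> \<subseteq> U q})"
    if r: "r < t" for x r
  proof
    assume "x \<in> {x. cball x \<delta> \<subseteq> U r}"
    then have sub: "y \<in> U r" if "y \<in> cball x \<delta>" for y
      using that by (simp only: mem_Collect_eq subset_iff)
    have "cball x \<delta> \<subseteq> (\<Union>q\<in>\<rat> \<inter> {..<r}. U q)"
    proof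
      fix y assume "y \<in> cball x \<delta>"
      then obtain q where "q \<in> \<rat>" "q < r" "y \<in> U q"
        using sub 1[of y r] by metis
      then show "y \<in> (\<Union>q\<in>\<rat> \<inter> {..<r}. U q)"
        by (intro UN_I[of q]) auto
    qed
    moreover have "open (U q)" if "q \<in> \<rat> \<inter> {..<r}" for q
      using that r assms by (intro open_U) auto
    ultimately obtain C where C: "C \<subseteq> \<rat> \<inter> {..<r}" "finite C" "cball x \<delta> \<subseteq> (\<Union>q\<in>C. U q)"
      using compactE_image[OF compact_cball, of "\<rat> \<inter> {..<r}" U x \<delta>] by metis
    \<comment> \<open>\<open>q0\<close> ensures that the maximum below is taken over a nonempty set
      of rationals less than \<open>r\<close>.\<close>
    obtain q0 where q0: "q0 \<in> \<rat>" "r - 1 < q0" "q0 < r"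
      using Rats_dense_in_real[of "r - 1" r] by auto
    define q where "q = Max (insert q0 C)"
    have "q \<in> insert q0 C"
      unfolding q_def using C(2) by (intro Max_in) auto
    then have "q \<in> \<rat>" "q < r"
      using C(1) q0 by auto
    moreover have "(\<Union>q\<in>C. U q) \<subseteq> U q"
      by (intro UN_least U_mono) (simp add: q_def C(2))
    then have "cball x \<delta> \<subseteq> U q"
      by (rule subset_trans[OF C(3)])
    ultimately show "\<exists>q\<in>\<rat>. q < r \<and> x \<in> {x. cball x \<delta> \<subseteq> U q}"
      by (intro bexI[of _ q] conjI CollectI)
  next
    assume "\<exists>q\<in>\<rat>. q < r \<and> x \<in> {x. cball x \<delta> \<subseteq> U q}"
    then obtain q where "q < r" "cball x \<delta> \<subseteq> U q"
      by auto
    then show "x \<in> {x. cball x \<delta> \<subseteq> U r}"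
      using subset_trans[OF _ U_mono[of q r]] by simp
  qed
  have "layer \<delta> s t = {(x, r). s < r \<and> r < t \<and> x \<in> U r}
      - {(x, r). s < r \<and> r < t \<and> x \<in> {x. cball x \<delta> \<subseteq> U r}}"
    unfolding layer_def by (intro set_eqI) (simp only: split_paired_all mem_Collect_eq Diff_iff prod.case, argo)
  moreover have "{(x, r). s < r \<and> r < t \<and> x \<in> U r} \<in> sets (lborel \<Otimes>\<^sub>M lborel)"
    using assms by (intro left_continuous_family_sets 1) auto
  moreover have "{(x, r). s < r \<and> r < t \<and> x \<in> {x. cball x \<delta> \<subseteq> U r}} \<in> sets (lborel \<Otimes>\<^sub>M lborel)"
  proof (rule left_continuous_family_sets[OF _ 2])
    show "{x. cball x \<delta> \<subseteq> U q} \<in> sets borel" if "q < t" for q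
      using assms that by (intro borel_open open_erosion open_U) auto
  qed
  ultimately show ?thesis
    by simp
qed

text \<open>Minimality of \<open>z\<close> forces \<open>cmod z \<le> r\<close>. A point
  \<open>y \<notin> U r\<close> within \<open>\<delta>\<close> of \<open>x\<close> has a preimage
  within \<open>L * \<delta>\<close> of \<open>z\<close>, and the modulus of that preimage is at
  least \<open>r\<close>. Hence the radii \<open>r\<close> lie in an interval of length
  \<open>L * \<delta>\<close>.\<close>

lemma layer_slice_le:
  assumes x: "x = f z" "x \<notin> U (cmod z)"
    and inv: "\<And>y. dist y x \<le> \<delta> \<Longrightarrow> \<exists>z'\<in>ball 0 1. f z' = y \<and> dist z' z \<le> L * dist y x"
    and L: "L \<ge> 0" "\<delta> \<ge> 0"
  shows "emeasure lborel (Pair x -` layer \<delta> s t) \<le> ennreal (L * \<delta>)"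
proof -
  have "Pair x -` layer \<delta> s t \<subseteq> {cmod z..cmod z + L * \<delta>}"
  proof
    fix r assume "r \<in> Pair x -` layer \<delta> s t"
    then have r: "x \<in> U r" "\<not> cball x \<delta> \<subseteq> U r"
      by (auto simp: layer_def)
    then obtain y where y: "dist y x \<le> \<delta>" "y \<notin> U r"
      by (auto simp: dist_commute subset_iff)
    then obtain z' where z': "f z' = y" "dist z' z \<le> L * dist y x"
      using inv by blast
    have "r \<le> cmod z'"
      using y(2) z'(1) by force
    moreover have "cmod z' \<le> cmod z + dist z' z"
      by (metis add.commute dist_norm norm_triangle_sub)
    moreover have "L * dist y x \<le> L * \<delta>"
      using y(1) L by (intro mult_left_mono) auto
    moreover have "cmod z \<le> r"
      using r(1) x(2) U_mono[of r "cmod z"] by (meson linear subsetD)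
    ultimately show "r \<in> {cmod z..cmod z + L * \<delta>}"
      using z'(2) by auto
  qed
  then have "emeasure lborel (Pair x -` layer \<delta> s t) \<le> emeasure lborel {cmod z..cmod z + L * \<delta>}"
    by (intro emeasure_mono) auto
  also have "\<dots> = ennreal (L * \<delta>)"
    using L by simp
  finally show ?thesis .
qed

text \<open>After division by \<open>\<delta>\<close> this is the integrable majorant for the
  passage to the limit in \<open>slope_integral_ge\<close>.\<close>

lemma layer_slice_bound:
  obtains L \<delta>0 where "L > 0" "\<delta>0 > 0"
    "\<And>\<delta> x s t. 0 < \<delta> \<Longrightarrow> \<delta> < \<delta>0 \<Longrightarrow> a \<le> s \<Longrightarrow> t \<le> b \<Longrightarrow>
      emeasure lborel (Pair x -` layer \<delta> s t) \<le> ennreal (L * \<delta>) * indicator (U b) x"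
proof -
  have cptE: "compact (cball 0 b - ball 0 a :: complex set)"
    by (intro compact_diff) auto
  obtain L \<delta>0 where L: "L > 0" "\<delta>0 > 0"
    "\<And>z y. z \<in> cball 0 b - ball 0 a \<Longrightarrow> dist y (f z) < \<delta>0 \<Longrightarrow>
        \<exists>z'\<in>ball 0 1. f z' = y \<and> dist z' z \<le> L * dist y (f z)"
    by (rule uniform_local_inverse_lipschitz[OF hol open_ball cptE])
       (use ab deriv_nz in auto)
  show ?thesis
  proof (rule that[OF L(1,2)])
    fix \<delta> s t :: real and x assume \<delta>: "0 < \<delta>" "\<delta> < \<delta>0" and st: "a \<le> s" "t \<le> b"
    consider "x \<notin> U b" | "x \<in> U b - U a" | "x \<in> U a" by blast
    then show "emeasure lborel (Pair x -` layer \<delta> s t) \<le> ennreal (L * \<delta>) * indicator (U b) x"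
    proof cases
      case 1
      then have "Pair x -` layer \<delta> s t = {}"
        using st U_mono[of _ b] by (fastforce simp: layer_def)
      then show ?thesis by simp
    next
      case 2
      then obtain z where z: "a \<le> cmod z" "cmod z \<le> b" "f z = x" "x \<notin> U (cmod z)"
        by (rule exists_minimal_preimage)
      have "emeasure lborel (Pair x -` layer \<delta> s t) \<le> ennreal (L * \<delta>)"
        using z L \<delta> by (intro layer_slice_le[where z = z]) auto
      then show ?thesis
        using 2 by simp
    next
      case 3
      \<comment> \<open>The least preimage of \<open>x\<close> has modulus below \<open>a\<close>,
        where \<open>deriv f\<close> may vanish. Instead, the segment from \<open>x\<close> to a
        point \<open>y\<close> outside \<open>U r\<close> meets the frontier of \<open>U a\<close>
        in the image of a point of modulus \<open>a\<close>, and the inverse estimate is applied at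
        that point.\<close>
      have "Pair x -` layer \<delta> s t \<subseteq> {a..a + L * \<delta>}"
      proof
        fix r assume "r \<in> Pair x -` layer \<delta> s t"
        then have r: "s < r" "r < t" "x \<in> U r" "\<not> cball x \<delta> \<subseteq> U r"
          by (auto simp: layer_def)
        then obtain y where y: "dist y x \<le> \<delta>" "y \<notin> U r"
          by (auto simp: dist_commute subset_iff)
        have "y \<notin> U a"
          using y(2) r(1) st(1) U_mono[of a r] by auto
        then have "closed_segment x y \<inter> frontier (U a) \<noteq> {}"
          using 3 by (intro connected_Int_frontier) auto
        then obtain x' where x': "x' \<in> closed_segment x y" "x' \<in> frontier (U a)"
          by blast
        have "closure (U a) \<subseteq> f ` cball 0 a"
          using ab by (intro closure_minimal compact_imp_closed compact_continuous_image cont) auto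
        moreover have "x' \<in> closure (U a)" "x' \<notin> U a"
          using x'(2) open_U[of a] ab by (auto simp: frontier_def interior_open)
        ultimately obtain z where z: "cmod z \<le> a" "x' = f z"
          by auto
        then have "cmod z = a"
          using \<open>x' \<notin> U a\<close> by force
        have "dist y x' \<le> \<delta>"
          using x'(1) y(1) by (smt (verit) dist_commute dist_norm norm_minus_commute segment_bound(2))
        then obtain z' where z': "f z' = y" "dist z' z \<le> L * dist y x'"
          using L(3)[of z y] \<open>cmod z = a\<close> ab \<delta> z by auto
        have "r \<le> cmod z'"
          using y(2) z'(1) by force
        moreover have "cmod z' \<le> cmod z + dist z' z"
          by (metis add.commute dist_norm norm_triangle_sub)
        moreover have "L * dist y x' \<le> L * \<delta>"
          using \<open>dist y x' \<le> \<delta>\<close> L by (intro mult_left_mono) auto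
        ultimately show "r \<in> {a..a + L * \<delta>}"
          using z'(2) z r(1) st(1) by auto
      qed
      then have "emeasure lborel (Pair x -` layer \<delta> s t) \<le> emeasure lborel {a..a + L * \<delta>}"
        by (intro emeasure_mono) auto
      also have "\<dots> = ennreal (L * \<delta>)"
        using L \<delta> by simp
      finally show ?thesis
        using 3 U_mono[of a b] ab by (auto simp: indicator_def)
    qed
  qed
qed

text \<open>For each \<open>r\<close> the strip is \<open>U r\<close> minus its erosion, so
  \<open>measure_erosion_le\<close> bounds its area. The erosion of \<open>U s\<close> is contained
  in that of \<open>U r\<close>, which makes the bound independent of \<open>r\<close>; then
  integrate over \<open>r\<close> and exchange the order of integration.\<close>

lemma nn_integral_layer_ge:
  assumes st: "s \<le> t" "t < 1" and \<delta>: "\<delta> > 0"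
  shows "ennreal (2 * sqrt pi * \<delta> * sqrt (measure lborel {x. cball x \<delta> \<subseteq> U s}) * (t - s))
    \<le> (\<integral>\<^sup>+x. emeasure lborel (Pair x -` layer \<delta> s t) \<partial>lborel)"
proof -
  let ?X = "\<lambda>r. {x. cball x \<delta> \<subseteq> U r}"
  let ?c = "2 * sqrt pi * \<delta> * sqrt (measure lborel (?X s))"
  have layer: "layer \<delta> s t \<in> sets (lborel \<Otimes>\<^sub>M lborel)"
    using st by (intro layer_sets) auto
  have slice: "ennreal ?c \<le> emeasure lborel ((\<lambda>x. (x, r)) -` layer \<delta> s t)" if r: "s < r" "r < t" for r
  proof -
    have sub: "?X s \<subseteq> ?X r"
      using subset_trans[OF _ U_mono[of s r]] r by (intro Collect_mono impI) simp
    have XU: "?X r \<subseteq> U r"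
      using \<delta> by (intro subsetI) (simp only: mem_Collect_eq, meson centre_in_cball less_imp_le subsetD)
    have X: "open (?X q)" if "q < t" for q
      using that st by (intro open_erosion open_U) auto
    have bX: "bounded (?X r)"
      using bounded_subset[OF bounded_U XU] r st by auto
    then have finX: "emeasure lborel (?X r) \<noteq> \<infinity>"
      using emeasure_bounded_finite[OF bX] by auto
    have eX: "emeasure lborel (?X r) = ennreal (measure lborel (?X r))"
      using finX by (intro emeasure_eq_ennreal_measure) auto
    have "measure lborel (?X s) \<le> measure lborel (?X r)"
      using X r sub finX by (intro measure_mono_fmeasurable) (auto simp: fmeasurable_def top.not_eq_extremum)
    then have "?c \<le> 2 * sqrt pi * \<delta> * sqrt (measure lborel (?X r))"
      using \<delta> by (intro mult_left_mono) auto
    also have "\<dots> \<le> A r - measure lborel (?X r)"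
      using measure_erosion_le[OF open_U bounded_U \<delta>, of r] r st by (simp add: A_def)
    finally have "ennreal ?c \<le> ennreal (A r - measure lborel (?X r))"
      by (rule ennreal_leI)
    also have "\<dots> = emeasure lborel (U r - ?X r)"
      using XU X r st finX by (subst emeasure_Diff) (auto simp: emeasure_U eX ennreal_minus)
    also have "U r - ?X r = (\<lambda>x. (x, r)) -` layer \<delta> s t"
      using r by (intro set_eqI) (simp only: layer_def vimage_eq mem_Collect_eq Diff_iff prod.case, argo)
    finally show ?thesis .
  qed
  have "ennreal (?c * (t - s)) = (\<integral>\<^sup>+r\<in>{s<..<t}. ennreal ?c \<partial>lborel)"
    using st \<delta> by (simp add: nn_integral_cmult_indicator ennreal_mult)
  also have "\<dots> \<le> (\<integral>\<^sup>+r. emeasure lborel ((\<lambda>x. (x, r)) -` layer \<delta> s t) \<partial>lborel)"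
    using slice by (intro nn_integral_mono) (auto simp: indicator_def)
  also have "\<dots> = emeasure (lborel \<Otimes>\<^sub>M lborel) (layer \<delta> s t)"
    by (rule lborel_pair.emeasure_pair_measure_alt2[OF layer, symmetric])
  also have "\<dots> = (\<integral>\<^sup>+x. emeasure lborel (Pair x -` layer \<delta> s t) \<partial>lborel)"
    by (rule lborel.emeasure_pair_measure_alt[OF layer])
  finally show ?thesis .
qed

lemma measure_erosion_tendsto:
  assumes \<delta>: "\<delta> \<longlonglongrightarrow> 0" "decseq \<delta>" and s: "s < 1"
  shows "(\<lambda>n. measure lborel {x. cball x (\<delta> n) \<subseteq> U s}) \<longlonglongrightarrow> A s"
proof -
  let ?X = "\<lambda>n. {x. cball x (\<delta> n) \<subseteq> U s}"
  have "\<exists>n. cball x (\<delta> n) \<subseteq> U s" if x: "x \<in> U s" for x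
  proof -
    obtain e where e: "e > 0" "ball x e \<subseteq> U s"
      using open_U[of s] s x by (meson less_imp_le openE)
    have "eventually (\<lambda>n. \<delta> n < e) sequentially"
      using \<delta>(1) e(1) by (rule order_tendstoD)
    then obtain n where "\<delta> n < e"
      by (auto simp: eventually_sequentially)
    then have "cball x (\<delta> n) \<subseteq> ball x e" by auto
    then show ?thesis
      using e(2) by (intro exI[of _ n]) (rule subset_trans)
  qed
  moreover have "x \<in> U s" if "cball x (\<delta> n) \<subseteq> U s" for x n
    using that decseq_ge[OF \<delta>(2,1), of n] by (meson centre_in_cball subsetD)
  ultimately have Un: "(\<Union>n. ?X n) = U s"
    by (intro equalityI subsetI) (simp_all only: UN_iff mem_Collect_eq, blast+)
  have meas: "range ?X \<subseteq> sets lborel"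
    using open_erosion[OF open_U[of s]] s by auto
  have inc: "incseq ?X"
  proof (intro monoI Collect_mono impI)
    fix i j :: nat and x assume "i \<le> j" and sub: "cball x (\<delta> i) \<subseteq> U s"
    then have "cball x (\<delta> j) \<subseteq> cball x (\<delta> i)"
      using decseqD[OF \<delta>(2)] by (intro subset_cball)
    then show "cball x (\<delta> j) \<subseteq> U s"
      using sub by (rule subset_trans)
  qed
  have "(\<lambda>n. measure lborel (?X n)) \<longlonglongrightarrow> measure lborel (\<Union>n. ?X n)"
    using emeasure_U[OF s] by (intro Lim_measure_incseq meas inc) (simp add: Un)
  then show ?thesis
    by (simp only: Un A_def)
qed

text \<open>Outside \<open>U t\<close> the slices are empty; in \<open>U s\<close> they are
  eventually empty, since a disc around \<open>x\<close> lies in \<open>U s\<close>. In between, the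
  local inverse at the preimage chosen by \<open>m\<close> gives the constant \<open>m x + e\<close>
  for every \<open>e > 0\<close>. One branch suffices because only an upper bound is wanted.\<close>

lemma limsup_layer_slice_le:
  assumes m: "minimal_slope m" and st: "a \<le> s" "s \<le> t" "t \<le> b"
    and \<delta>: "\<delta> \<longlonglongrightarrow> 0" "\<And>n. \<delta> n > 0"
  shows "limsup (\<lambda>n. ennreal (1 / \<delta> n) * emeasure lborel (Pair x -` layer (\<delta> n) s t))
    \<le> ennreal (m x) * indicator (U t - U s) x"
proof -
  note m0 = minimal_slopeD(2)[OF m]
  let ?u = "\<lambda>n. ennreal (1 / \<delta> n) * emeasure lborel (Pair x -` layer (\<delta> n) s t)"
  have small: "eventually (\<lambda>n. \<delta> n < e) sequentially" if "e > 0" for e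
    using \<delta>(1) that by (rule order_tendstoD)
  consider "x \<notin> U t" | "x \<in> U s" | "x \<in> U t - U s" by blast
  then show ?thesis
  proof cases
    case 1
    have "x \<notin> U r" if "r < t" for r
      using 1 U_mono[of r t] that by (meson less_imp_le subsetD)
    then have "Pair x -` layer (\<delta> n) s t = {}" for n
      by (intro equals0I) (simp only: layer_def vimage_eq mem_Collect_eq prod.case, metis)
    then show ?thesis by (simp add: Limsup_const)
  next
    case 2
    have "open (U s)"
      using st ab by (intro open_U) auto
    then obtain e where e: "e > 0" "ball x e \<subseteq> U s"
      using 2 by (meson openE)
    have "limsup ?u \<le> 0"
    proof (rule Limsup_bounded)
      show "eventually (\<lambda>n. ?u n \<le> 0) sequentially"
        using small[OF e(1)]
      proof eventually_elim
        case (elim n)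
        have "cball x (\<delta> n) \<subseteq> ball x e"
          using elim by auto
        then have "cball x (\<delta> n) \<subseteq> U r" if "s < r" for r
          using subset_trans[OF subset_trans[OF _ e(2)] U_mono[of s r]] that by simp
        then have "Pair x -` layer (\<delta> n) s t = {}"
          by (intro equals0I) (simp only: layer_def vimage_eq mem_Collect_eq prod.case, metis)
        then show ?case by simp
      qed
    qed
    then show ?thesis by simp
  next
    case 3
    have "x \<in> U b - U a"
      using 3 U_mono[of a s] U_mono[of t b] st by (meson Diff_iff subsetD)
    then obtain z where z: "a \<le> cmod z" "cmod z \<le> b" "f z = x" "x \<notin> U (cmod z)"
      and mz: "m x = 1 / cmod (deriv f z)"
      using minimal_slopeD(3)[OF m, of x] by metis
    have "limsup ?u \<le> ennreal (m x)"
    proof (rule ennreal_le_epsilon)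
      fix e :: real assume e: "e > 0"
      obtain N d where N: "open N" "z \<in> N" "d > 0"
        "\<And>z1 y. z1 \<in> N \<Longrightarrow> dist y (f z1) < d \<Longrightarrow>
          \<exists>z'\<in>ball 0 1. f z' = y \<and> dist z' z1 \<le> (m x + e) * dist y (f z1)"
        by (rule local_inverse_lipschitz[OF hol open_ball, of z "m x + e"])
          (use z ab deriv_nz e in \<open>auto simp: mz\<close>)
      have "eventually (\<lambda>n. ?u n \<le> ennreal (m x + e)) sequentially"
        using small[OF N(3)]
      proof eventually_elim
        case (elim n)
        have "emeasure lborel (Pair x -` layer (\<delta> n) s t) \<le> ennreal ((m x + e) * \<delta> n)"
          using N(4)[OF N(2)] z elim e m0[of x] \<delta>(2)[of n]
          by (intro layer_slice_le[where z = z]) auto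
        then have "?u n \<le> ennreal (1 / \<delta> n) * ennreal ((m x + e) * \<delta> n)"
          by (intro mult_left_mono) auto
        also have "\<dots> = ennreal (m x + e)"
          using \<delta>(2)[of n] m0[of x] e by (simp flip: ennreal_mult)
        finally show ?case .
      qed
      then have "limsup ?u \<le> ennreal (m x + e)"
        by (rule Limsup_bounded)
      then show "limsup ?u \<le> ennreal (m x) + ennreal e"
        using m0[of x] e by (simp add: ennreal_plus)
    qed
    then show ?thesis
      using 3 by simp
  qed
qed

text \<open>Divide the layer estimate by \<open>\<delta>\<close> and let \<open>\<delta>\<close>
  tend to 0. The lower bound converges because the erosions exhaust \<open>U s\<close>; the
  integrals are handled by the reverse Fatou lemma with the majorant \<open>L\<close> on
  \<open>U b\<close>.\<close>

lemma slope_integral_ge: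
  assumes m: "minimal_slope m" and st: "a \<le> s" "s \<le> t" "t \<le> b"
  shows "ennreal (2 * sqrt (pi * A s) * (t - s)) \<le> (\<integral>\<^sup>+w\<in>U t - U s. ennreal (m w) \<partial>lborel)"
proof -
  obtain L \<delta>0 where L: "L > 0" "\<delta>0 > 0"
    "\<And>\<delta> x s t. 0 < \<delta> \<Longrightarrow> \<delta> < \<delta>0 \<Longrightarrow> a \<le> s \<Longrightarrow> t \<le> b \<Longrightarrow>
      emeasure lborel (Pair x -` layer \<delta> s t) \<le> ennreal (L * \<delta>) * indicator (U b) x"
    using layer_slice_bound by metis
  \<comment> \<open>The shift by 2 makes even the first term strictly smaller than
    \<open>\<delta>0\<close>.\<close>
  define \<delta> where "\<delta> n = \<delta>0 / (real n + 2)" for n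
  have \<delta>: "\<delta> n > 0" "\<delta> n < \<delta>0" for n
    using L(2) by (auto simp: \<delta>_def field_simps intro: add_pos_nonneg)
  have \<delta>_lim: "\<delta> \<longlonglongrightarrow> 0"
    unfolding \<delta>_def
    by (intro real_tendsto_divide_at_top[OF tendsto_const]
        filterlim_tendsto_add_at_top[OF tendsto_const filterlim_real_sequentially, of 2, simplified add.commute])
  have \<delta>_dec: "decseq \<delta>"
    using L(2) by (auto simp: \<delta>_def decseq_def intro!: divide_left_mono)
  have t1: "t < 1" using st ab by simp
  define u where "u n x = ennreal (1 / \<delta> n) * emeasure lborel (Pair x -` layer (\<delta> n) s t)" for n x
  have um: "u n \<in> borel_measurable lborel" for n
    unfolding u_def
    by (intro borel_measurable_times_ennreal borel_measurable_const
        lborel.measurable_emeasure_Pair layer_sets) (use t1 in simp)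
  define c where "c n = 2 * sqrt pi * sqrt (measure lborel {x. cball x (\<delta> n) \<subseteq> U s}) * (t - s)" for n
  have uc: "ennreal (c n) \<le> integral\<^sup>N lborel (u n)" for n
  proof -
    have "ennreal (c n) = ennreal (1 / \<delta> n) *
        ennreal (2 * sqrt pi * \<delta> n * sqrt (measure lborel {x. cball x (\<delta> n) \<subseteq> U s}) * (t - s))"
      using \<delta>[of n] st by (simp add: c_def flip: ennreal_mult)
    also have "\<dots> \<le> ennreal (1 / \<delta> n) * (\<integral>\<^sup>+x. emeasure lborel (Pair x -` layer (\<delta> n) s t) \<partial>lborel)"
      using st t1 \<delta> by (intro mult_left_mono nn_integral_layer_ge) auto
    also have "\<dots> = integral\<^sup>N lborel (u n)"
      unfolding u_def using t1
      by (intro nn_integral_cmult[symmetric] lborel.measurable_emeasure_Pair layer_sets) auto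
    finally show ?thesis .
  qed
  have ub: "u n x \<le> ennreal L * indicator (U b) x" for n x
  proof -
    have "u n x \<le> ennreal (1 / \<delta> n) * (ennreal (L * \<delta> n) * indicator (U b) x)"
      unfolding u_def using L(3)[OF \<delta> st(1,3)] by (intro mult_left_mono) auto
    also have "\<dots> = ennreal L * indicator (U b) x"
      using \<delta>[of n] L(1) by (simp add: mult.assoc[symmetric] flip: ennreal_mult)
    finally show ?thesis .
  qed
  have "(\<lambda>n. ennreal (c n)) \<longlonglongrightarrow> ennreal (2 * sqrt pi * sqrt (A s) * (t - s))"
    unfolding c_def using st t1
    by (intro tendsto_intros tendsto_ennrealI measure_erosion_tendsto \<delta>_lim \<delta>_dec) auto
  then have "ennreal (2 * sqrt pi * sqrt (A s) * (t - s)) = limsup (\<lambda>n. ennreal (c n))"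
    by (intro lim_imp_Limsup[symmetric]) auto
  also have "\<dots> \<le> limsup (\<lambda>n. integral\<^sup>N lborel (u n))"
    using uc by (intro Limsup_mono) auto
  also have "\<dots> \<le> (\<integral>\<^sup>+x. limsup (\<lambda>n. u n x) \<partial>lborel)"
  proof (rule nn_integral_limsup[OF um])
    show "(\<lambda>x. ennreal L * indicator (U b) x) \<in> borel_measurable lborel"
      using ab by (auto intro!: borel_measurable_times_ennreal borel_measurable_indicator)
    show "AE x in lborel. u n x \<le> ennreal L * indicator (U b) x" for n
      using ub by simp
    show "(\<integral>\<^sup>+x. ennreal L * indicator (U b) x \<partial>lborel) < \<infinity>"
      using ab by (subst nn_integral_cmult_indicator) (auto simp: emeasure_U ennreal_mult_less_top)
  qed
  also have "\<dots> \<le> (\<integral>\<^sup>+w\<in>U t - U s. ennreal (m w) \<partial>lborel)"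
    unfolding u_def by (intro nn_integral_mono limsup_layer_slice_le m st \<delta>_lim \<delta>)
  finally show ?thesis
    by (simp add: real_sqrt_mult mult.assoc)
qed

end

section \<open>Growth of the area ratio\<close>

text \<open>Telescoping over \<open>n + 1\<close> equal steps costs
  \<open>C * (b - a)^2 / (n + 1)\<close> in total, which tends to 0. This replaces a derivative
  argument, as \<open>h\<close> need not be differentiable.\<close>

lemma le_if_diff_ge_neg_square:
  fixes h :: "real \<Rightarrow> real"
  assumes ab: "a \<le> b"
    and h: "\<And>x y. a \<le> x \<Longrightarrow> x \<le> y \<Longrightarrow> y \<le> b \<Longrightarrow> - C * (y - x)\<^sup>2 \<le> h y - h x"
  shows "h a \<le> h b"
proof -
  have "h a - h b \<le> C * (b - a)\<^sup>2 / real (Suc n)" for n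
  proof -
    define d where "d = (b - a) / real (Suc n)"
    have d: "d \<ge> 0" "real (Suc n) * d = b - a"
      using ab by (auto simp: d_def)
    have "- C * d\<^sup>2 \<le> h (a + real (Suc i) * d) - h (a + real i * d)" if "i < Suc n" for i
    proof -
      have "real (Suc i) * d \<le> real (Suc n) * d"
        using that d(1) by (intro mult_right_mono) auto
      then show ?thesis
        using h[of "a + real i * d" "a + real (Suc i) * d"] d by (simp add: algebra_simps)
    qed
    then have "(\<Sum>i<Suc n. - C * d\<^sup>2) \<le> (\<Sum>i<Suc n. h (a + real (Suc i) * d) - h (a + real i * d))"
      by (intro sum_mono) auto
    also have "\<dots> = h (a + real (Suc n) * d) - h (a + real 0 * d)"
      by (rule sum_lessThan_telescope)
    also have "\<dots> = h b - h a"
      unfolding d(2) by simp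
    also have "(\<Sum>i<Suc n. - C * d\<^sup>2) = - (C * (real (Suc n) * d) * d)"
      by (simp add: power2_eq_square algebra_simps)
    also have "\<dots> = - (C * (b - a)\<^sup>2 / real (Suc n))"
      unfolding d(2) by (simp add: d_def power2_eq_square)
    finally show ?thesis by simp
  qed
  moreover have "(\<lambda>n. C * (b - a)\<^sup>2 / real (Suc n)) \<longlonglongrightarrow> 0"
    by (rule LIMSEQ_Suc[OF lim_const_over_n])
  ultimately have "h a - h b \<le> 0"
    by (intro LIMSEQ_le_const) auto
  then show ?thesis by simp
qed

lemma linear_on_disc_if_deriv_deriv_zero:
  assumes f: "f holomorphic_on ball 0 1" and 0: "\<And>z. z \<in> ball 0 1 \<Longrightarrow> deriv (deriv f) z = 0"
  shows "linear_on_disc f"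
proof -
  have "\<exists>c. \<forall>z\<in>ball 0 1. deriv f z = c"
  proof (rule has_field_derivative_zero_constant)
    fix z :: complex assume z: "z \<in> ball 0 1"
    show "(deriv f has_field_derivative 0) (at z within ball 0 1)"
      using holomorphic_derivI[OF holomorphic_deriv[OF f open_ball] open_ball z] 0[OF z]
      by simp
  qed auto
  then obtain c where c: "\<And>z. z \<in> ball 0 1 \<Longrightarrow> deriv f z = c" by blast
  have "\<exists>d. \<forall>z\<in>ball 0 1. f z - c * z = d"
  proof (rule has_field_derivative_zero_constant)
    fix z :: complex assume z: "z \<in> ball 0 1"
    have "((\<lambda>z. f z - c * z) has_field_derivative deriv f z - c) (at z within ball 0 1)"
      by (auto intro!: derivative_eq_intros holomorphic_derivI[OF f open_ball z])
    then show "((\<lambda>z. f z - c * z) has_field_derivative 0) (at z within ball 0 1)"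
      using c[OF z] by simp
  qed auto
  then obtain d where "\<And>z. z \<in> ball 0 1 \<Longrightarrow> f z - c * z = d" by blast
  then show ?thesis
    unfolding linear_on_disc_def by (intro exI[of _ c] exI[of _ d]) (auto simp: algebra_simps)
qed

text \<open>Where \<open>deriv h\<close> does not vanish, the level set is locally contained in the
  image of part of a circle under a smooth inverse branch. The zeros of \<open>deriv h\<close> in
  \<open>K\<close> are finite in number.\<close>

lemma negligible_level_set_cmod:
  assumes h: "h holomorphic_on S" "open S" and S: "connected S" and K: "compact K" "K \<subseteq> S"
    and nc: "\<exists>z\<in>S. deriv h z \<noteq> 0"
  shows "negligible {z \<in> K. cmod (h z) = \<kappa>}"
proof -
  have fin: "finite {z \<in> K. deriv h z = 0}"
  proof (cases "deriv h constant_on S")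
    case True
    then have "{z \<in> K. deriv h z = 0} = {}"
      using nc K(2) by (auto simp: constant_on_def)
    then show ?thesis by (simp only: finite.emptyI)
  next
    case False
    then show ?thesis
      by (rule holomorphic_compact_finite_zeros[OF holomorphic_deriv[OF h] h(2) S K])
  qed
  define Z where "Z = {z \<in> S. cmod (h z) = \<kappa> \<and> deriv h z \<noteq> 0}"
  have "negligible Z"
  proof (rule locally_negligible_alt[THEN iffD2], rule)
    fix z assume z: "z \<in> Z"
    then have "z \<in> S" "deriv h z \<noteq> 0"
      by (auto simp: Z_def)
    then obtain r where r: "r > 0" "ball z r \<subseteq> S" "inj_on h (ball z r)"
      using has_complex_derivative_locally_injective[OF h(1) _ h(2)] by metis
    have holB: "h holomorphic_on ball z r"
      using h(1) r(2) by (rule holomorphic_on_subset)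
    have "open (h ` ball z r)"
      by (rule open_mapping_thm3[OF holB open_ball r(3)])
    obtain g where g: "g holomorphic_on h ` ball z r" "\<And>z'. z' \<in> ball z r \<Longrightarrow> g (h z') = z'"
      using holomorphic_has_inverse[OF holB open_ball r(3)] by metis
    have "negligible (g ` (sphere 0 \<kappa> \<inter> h ` ball z r))"
    proof (rule negligible_differentiable_image_negligible)
      show "negligible (sphere 0 \<kappa> \<inter> h ` ball z r)"
        by (intro negligible_Int) (auto intro: negligible_sphere)
      have "g differentiable_on h ` ball z r"
        using g(1) by (rule holomorphic_on_imp_differentiable_on)
      then show "g differentiable_on (sphere 0 \<kappa> \<inter> h ` ball z r)"
        by (rule differentiable_on_subset) auto
    qed simp
    moreover have "Z \<inter> ball z r \<subseteq> g ` (sphere 0 \<kappa> \<inter> h ` ball z r)"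
    proof
      fix y assume y: "y \<in> Z \<inter> ball z r"
      then show "y \<in> g ` (sphere 0 \<kappa> \<inter> h ` ball z r)"
        using g(2)[of y] by (intro image_eqI[of _ _ "h y"]) (auto simp: Z_def)
    qed
    ultimately have "negligible (Z \<inter> ball z r)"
      by (rule negligible_subset)
    then show "\<exists>U. openin (top_of_set Z) U \<and> z \<in> U \<and> negligible U"
      using z r(1) by (intro exI[of _ "Z \<inter> ball z r"]) (auto intro: openin_open_Int)
  qed
  then have "negligible (Z \<union> {z \<in> K. deriv h z = 0})"
    by (rule negligible_Un[OF _ negligible_finite[OF fin]])
  then show ?thesis
    by (rule negligible_subset) (use K(2) in \<open>auto simp: Z_def\<close>)
qed

context regular_annulus
begin

text \<open>A finite form of \<open>A' \<ge> 2 * A / r\<close>. Cauchy--Schwarz is carried out by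
  integrating \<open>2 * \<kappa> * m \<le> \<kappa>^2 * m^2 + 1\<close> over
  \<open>U b - U a\<close>, with the slope inequality on the left and the bound for the integral of
  \<open>m^2\<close> on the right.\<close>

lemma area_step: "4 * A a * (b - a) / (a + b) \<le> A b - A a"
proof -
  obtain m where ms: "minimal_slope m"
    and m2: "(\<integral>\<^sup>+w. ennreal ((m w)\<^sup>2) \<partial>lborel) \<le> ennreal (pi * (b\<^sup>2 - a\<^sup>2))"
    using exists_minimal_slope by (elim exE conjE)
  note m = minimal_slopeD[OF ms]
  note [measurable] = m(1)
  have J: "ennreal (2 * sqrt (pi * A a) * (b - a)) \<le> (\<integral>\<^sup>+w\<in>U b - U a. ennreal (m w) \<partial>lborel)"
    using ab by (intro slope_integral_ge ms) auto
  have R[measurable]: "U b - U a \<in> sets borel"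
    using ab by auto
  have ba: "b\<^sup>2 - a\<^sup>2 = (b - a) * (a + b)"
    by (simp add: power2_eq_square algebra_simps)
  \<comment> \<open>This value maximizes \<open>4 * \<kappa> * sqrt (pi * A a) * (b - a) -
    \<kappa>^2 * pi * (b^2 - a^2)\<close>, the lower bound obtained for
    \<open>A b - A a\<close>.\<close>
  define \<kappa> where "\<kappa> = 2 * sqrt (A a / pi) / (a + b)"
  have \<kappa>: "\<kappa> \<ge> 0"
    using ab A_nonneg by (simp add: \<kappa>_def)
  have "ennreal (2 * \<kappa>) * ennreal (2 * sqrt (pi * A a) * (b - a))
      \<le> ennreal (2 * \<kappa>) * (\<integral>\<^sup>+w\<in>U b - U a. ennreal (m w) \<partial>lborel)"
    by (intro mult_left_mono J) auto
  also have "\<dots> = (\<integral>\<^sup>+w. ennreal (2 * \<kappa>) * (ennreal (m w) * indicator (U b - U a) w) \<partial>lborel)"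
    by (rule nn_integral_cmult[symmetric]) measurable
  also have "\<dots> \<le> (\<integral>\<^sup>+w. ennreal (\<kappa>\<^sup>2) * ennreal ((m w)\<^sup>2) + indicator (U b - U a) w \<partial>lborel)"
  proof (rule nn_integral_mono)
    fix w
    have "0 \<le> (\<kappa> * m w - 1)\<^sup>2" by simp
    then have "2 * \<kappa> * m w \<le> \<kappa>\<^sup>2 * (m w)\<^sup>2 + 1"
      by (simp add: power2_diff power_mult_distrib algebra_simps)
    then have "ennreal (2 * \<kappa> * m w) \<le> ennreal (\<kappa>\<^sup>2 * (m w)\<^sup>2 + 1)"
      by (rule ennreal_leI)
    then have "ennreal (2 * \<kappa>) * ennreal (m w) \<le> ennreal (\<kappa>\<^sup>2) * ennreal ((m w)\<^sup>2) + 1"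
      using m(2)[of w] \<kappa> by (simp add: ennreal_mult ennreal_plus)
    then show "ennreal (2 * \<kappa>) * (ennreal (m w) * indicator (U b - U a) w)
        \<le> ennreal (\<kappa>\<^sup>2) * ennreal ((m w)\<^sup>2) + indicator (U b - U a) w"
      by (simp split: split_indicator)
  qed
  also have "\<dots> = ennreal (\<kappa>\<^sup>2) * (\<integral>\<^sup>+w. ennreal ((m w)\<^sup>2) \<partial>lborel) + emeasure lborel (U b - U a)"
    by (subst nn_integral_add) (auto simp: nn_integral_cmult)
  also have "\<dots> \<le> ennreal (\<kappa>\<^sup>2) * ennreal (pi * (b\<^sup>2 - a\<^sup>2)) + ennreal (A b - A a)"
    using ab by (intro add_mono mult_left_mono m2) (auto simp: emeasure_U_diff)
  also have "\<dots> = ennreal (\<kappa>\<^sup>2 * (pi * (b\<^sup>2 - a\<^sup>2)) + (A b - A a))"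
    using ab A_mono[of a b] by (subst ennreal_plus) (auto simp: ennreal_mult ba)
  finally have "ennreal (2 * \<kappa> * (2 * sqrt (pi * A a) * (b - a))) \<le> \<dots>"
    using \<kappa> ab A_nonneg by (simp flip: ennreal_mult)
  moreover have "0 \<le> \<kappa>\<^sup>2 * (pi * (b\<^sup>2 - a\<^sup>2)) + (A b - A a)"
    using ab A_mono[of a b] by (auto simp: ba)
  ultimately have le: "2 * \<kappa> * (2 * sqrt (pi * A a) * (b - a)) \<le> \<kappa>\<^sup>2 * (pi * (b\<^sup>2 - a\<^sup>2)) + (A b - A a)"
    by (simp add: ennreal_le_iff)
  have "2 * \<kappa> * (2 * sqrt (pi * A a) * (b - a)) = 8 * (sqrt (A a / pi) * sqrt (pi * A a)) * (b - a) / (a + b)"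
    by (simp add: \<kappa>_def)
  also have "sqrt (A a / pi) * sqrt (pi * A a) = A a"
    using A_nonneg[of a] by (simp add: real_sqrt_mult[symmetric])
  finally have 1: "2 * \<kappa> * (2 * sqrt (pi * A a) * (b - a)) = 8 * A a * (b - a) / (a + b)" .
  have "\<kappa>\<^sup>2 * pi = 4 * A a / (a + b)\<^sup>2"
    using A_nonneg[of a] by (simp add: \<kappa>_def power_divide power_mult_distrib)
  then have "\<kappa>\<^sup>2 * (pi * (b\<^sup>2 - a\<^sup>2)) = 4 * A a / (a + b)\<^sup>2 * ((b - a) * (a + b))"
    by (metis ba mult.assoc)
  also have "\<dots> = 4 * A a * (b - a) / (a + b)"
    using ab by (simp add: power2_eq_square)
  finally have 2: "\<kappa>\<^sup>2 * (pi * (b\<^sup>2 - a\<^sup>2)) = 4 * A a * (b - a) / (a + b)" .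
  have 3: "8 * A a * (b - a) / (a + b) = 4 * A a * (b - a) / (a + b) + 4 * A a * (b - a) / (a + b)"
    by simp
  show ?thesis
    using le unfolding 1 2 3 by (simp only: add_le_cancel_left)
qed

lemma subannulus: "a \<le> s \<Longrightarrow> s < t \<Longrightarrow> t \<le> b \<Longrightarrow> regular_annulus f s t"
  using hol ab deriv_nz by unfold_locales auto

text \<open>On each subinterval from \<open>x\<close> to \<open>y\<close>, \<open>area_step\<close>
  gives monotonicity of the ratio up to an error of order \<open>(y - x)^2\<close>, which vanishes
  under refinement.\<close>

lemma area_ratio_mono: "A a / a\<^sup>2 \<le> A b / b\<^sup>2"
proof (rule le_if_diff_ge_neg_square[of a b "4 * (A b / a\<^sup>2) / a\<^sup>2"])
  fix x y assume xy: "a \<le> x" "x \<le> y" "y \<le> b"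
  show "- (4 * (A b / a\<^sup>2) / a\<^sup>2) * (y - x)\<^sup>2 \<le> A y / y\<^sup>2 - A x / x\<^sup>2"
  proof (cases "x = y")
    case False
    then interpret s: regular_annulus f x y
      using subannulus[of x y] xy by simp
    have pos: "x > 0" "y > 0" using xy ab by auto
    have "A x * (1 + 4 * (y - x) / (x + y)) \<le> A y"
      using s.area_step unfolding s.A_def A_def by (simp add: algebra_simps)
    then have "A x * (1 + 4 * (y - x) / (x + y)) / y\<^sup>2 \<le> A y / y\<^sup>2"
      by (rule divide_right_mono) simp
    \<comment> \<open>The growth factor agrees with \<open>y^2 / x^2\<close> up to an explicit
      quadratic error. Its coefficient is bounded below using
      \<open>3 * x + y \<le> 4 * (x + y)\<close> and \<open>a \<le> y\<close>.\<close>
    moreover have "A x * (1 + 4 * (y - x) / (x + y)) / y\<^sup>2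
        = A x / x\<^sup>2 - A x / x\<^sup>2 * ((3 * x + y) * (y - x)\<^sup>2 / (y\<^sup>2 * (x + y)))"
    proof -
      have "x\<^sup>2 * (1 + 4 * (y - x) / (x + y)) / y\<^sup>2 = 1 - (3 * x + y) * (y - x)\<^sup>2 / (y\<^sup>2 * (x + y))"
      proof -
        have "x\<^sup>2 * (x + y + 4 * (y - x)) = y\<^sup>2 * (x + y) - (3 * x + y) * (y - x)\<^sup>2"
          by (simp add: power2_eq_square algebra_simps)
        moreover have "1 + 4 * (y - x) / (x + y) = (x + y + 4 * (y - x)) / (x + y)"
          using pos by (simp add: field_simps)
        ultimately have "x\<^sup>2 * (1 + 4 * (y - x) / (x + y)) / y\<^sup>2
            = (y\<^sup>2 * (x + y) - (3 * x + y) * (y - x)\<^sup>2) / (y\<^sup>2 * (x + y))"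
          by (simp add: mult.commute)
        then show ?thesis
          using pos by (simp add: diff_divide_distrib)
      qed
      then have "A x / x\<^sup>2 * (x\<^sup>2 * (1 + 4 * (y - x) / (x + y)) / y\<^sup>2)
          = A x / x\<^sup>2 * (1 - (3 * x + y) * (y - x)\<^sup>2 / (y\<^sup>2 * (x + y)))"
        by simp
      then show ?thesis
        using pos by (simp add: right_diff_distrib)
    qed
    moreover have "A x / x\<^sup>2 * ((3 * x + y) * (y - x)\<^sup>2 / (y\<^sup>2 * (x + y)))
        \<le> A b / a\<^sup>2 * (4 / a\<^sup>2 * (y - x)\<^sup>2)"
    proof (rule mult_mono)
      show "A x / x\<^sup>2 \<le> A b / a\<^sup>2"
        using xy ab A_mono[of x b] A_nonneg by (intro frac_le power_mono) auto
      have "(3 * x + y) / (x + y) / y\<^sup>2 \<le> 4 / a\<^sup>2"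
        using pos xy ab by (intro frac_le power_mono) (auto simp: divide_le_eq)
      then have "(3 * x + y) / (x + y) / y\<^sup>2 * (y - x)\<^sup>2 \<le> 4 / a\<^sup>2 * (y - x)\<^sup>2"
        by (rule mult_right_mono) simp
      then show "(3 * x + y) * (y - x)\<^sup>2 / (y\<^sup>2 * (x + y)) \<le> 4 / a\<^sup>2 * (y - x)\<^sup>2"
        by (simp add: mult_ac)
    qed (use pos A_nonneg in auto)
    ultimately show ?thesis
      by (simp add: mult_ac)
  qed simp
qed (use ab in simp)

lemma A_pos: "0 < t \<Longrightarrow> t < 1 \<Longrightarrow> 0 < A t"
proof -
  assume t: "0 < t" "t < 1"
  have "\<not> negligible (U t)"
    using t by (intro open_not_negligible open_U) auto
  then have "emeasure lborel (U t) \<noteq> 0"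
    using t by (auto simp: negligible_iff_emeasure0)
  then show ?thesis
    using t emeasure_U[of t] A_nonneg[of t] by auto
qed

text \<open>If the area ratio does not increase strictly, then it is constant on \<open>[a, b]\<close>, so the slope
  inequality is sharp for almost every radius and forces \<open>cmod (deriv f z)\<close> to be a constant on a
  set of positive area.\<close>

lemma area_ratio_strict_mono:
  assumes nonlinear: "\<not> linear_on_disc f"
  shows "A a / a\<^sup>2 < A b / b\<^sup>2"
proof (rule ccontr)
  assume "\<not> ?thesis"
  then have eq: "A b / b\<^sup>2 = A a / a\<^sup>2"
    using area_ratio_mono by simp
  \<comment> \<open>On this scale \<open>A t\<close> will be the area of a disc of radius
    \<open>\<kappa> * t\<close>; the aim is \<open>\<kappa> * m = 1\<close> almost everywhere on
    \<open>U b - U a\<close>.\<close>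
  define \<kappa> where "\<kappa> = sqrt (A a / a\<^sup>2 / pi)"
  have \<kappa>: "\<kappa> > 0" and c: "A a / a\<^sup>2 = pi * \<kappa>\<^sup>2"
    using A_pos[of a] ab by (auto simp: \<kappa>_def)
  have A: "A t = pi * \<kappa>\<^sup>2 * t\<^sup>2" if t: "a \<le> t" "t \<le> b" for t
  proof -
    have "A x / x\<^sup>2 \<le> A y / y\<^sup>2" if "a \<le> x" "x \<le> y" "y \<le> b" for x y
    proof (cases "x = y")
      case False
      then interpret s: regular_annulus f x y
        using that by (intro subannulus) auto
      show ?thesis
        using s.area_ratio_mono by (simp add: s.A_def A_def)
    qed simp
    then have "A t / t\<^sup>2 = pi * \<kappa>\<^sup>2"
      using t ab eq c by (metis order.antisym order.refl less_imp_le)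
    then show ?thesis
      using t ab by (simp add: field_simps)
  qed
  obtain m where ms: "minimal_slope m"
    and m2: "(\<integral>\<^sup>+w. ennreal ((m w)\<^sup>2) \<partial>lborel) \<le> ennreal (pi * (b\<^sup>2 - a\<^sup>2))"
    using exists_minimal_slope by (elim exE conjE)
  note m = minimal_slopeD[OF ms]
  note [measurable] = m(1)
  define R where "R = U b - U a"
  have R[measurable]: "R \<in> sets borel"
    unfolding R_def using ab by auto
  define J where "J t = (\<integral>\<^sup>+w\<in>U t - U a. ennreal (m w) \<partial>lborel)" for t
  \<comment> \<open>\<open>F\<close> is the deficit in
    \<open>2 * \<kappa> * m \<le> \<kappa>^2 * m^2 + 1\<close>; its integral is shown to
    vanish.\<close>
  define F where "F w = ennreal ((\<kappa> * m w - 1)\<^sup>2) * indicator R w" for w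
  have Fm[measurable]: "F \<in> borel_measurable borel"
    unfolding F_def by measurable
  have "(\<integral>\<^sup>+w. F w \<partial>lborel) + ennreal (2 * \<kappa>) * J b
      = (\<integral>\<^sup>+w. F w + ennreal (2 * \<kappa>) * (ennreal (m w) * indicator R w) \<partial>lborel)"
    unfolding J_def R_def[symmetric] by (subst nn_integral_add) (auto simp: nn_integral_cmult)
  also have "\<dots> \<le> (\<integral>\<^sup>+w. ennreal (\<kappa>\<^sup>2) * ennreal ((m w)\<^sup>2) + indicator R w \<partial>lborel)"
  proof (rule nn_integral_mono)
    fix w
    have "(\<kappa> * m w - 1)\<^sup>2 + 2 * \<kappa> * m w = \<kappa>\<^sup>2 * (m w)\<^sup>2 + 1"
      by (simp add: power2_diff power_mult_distrib)
    then have "ennreal ((\<kappa> * m w - 1)\<^sup>2 + 2 * \<kappa> * m w) = ennreal (\<kappa>\<^sup>2 * (m w)\<^sup>2 + 1)"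
      by simp
    then have "ennreal ((\<kappa> * m w - 1)\<^sup>2) + ennreal (2 * \<kappa>) * ennreal (m w)
        = ennreal (\<kappa>\<^sup>2) * ennreal ((m w)\<^sup>2) + 1"
      using m(2)[of w] \<kappa> by (simp add: ennreal_mult ennreal_plus)
    then show "F w + ennreal (2 * \<kappa>) * (ennreal (m w) * indicator R w)
        \<le> ennreal (\<kappa>\<^sup>2) * ennreal ((m w)\<^sup>2) + indicator R w"
      by (simp add: F_def split: split_indicator)
  qed
  also have "\<dots> = ennreal (\<kappa>\<^sup>2) * (\<integral>\<^sup>+w. ennreal ((m w)\<^sup>2) \<partial>lborel) + emeasure lborel R"
    by (subst nn_integral_add) (auto simp: nn_integral_cmult)
  also have "\<dots> \<le> ennreal (\<kappa>\<^sup>2) * ennreal (pi * (b\<^sup>2 - a\<^sup>2)) + ennreal (A b - A a)"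
    using ab by (intro add_mono mult_left_mono m2) (auto simp: R_def emeasure_U_diff)
  also have "\<dots> = ennreal (2 * \<kappa> * (pi * \<kappa> * (b\<^sup>2 - a\<^sup>2)))"
  proof -
    have "a\<^sup>2 \<le> b\<^sup>2" using ab by (intro power_mono) auto
    then have "ennreal (\<kappa>\<^sup>2) * ennreal (pi * (b\<^sup>2 - a\<^sup>2)) + ennreal (A b - A a)
        = ennreal (\<kappa>\<^sup>2 * (pi * (b\<^sup>2 - a\<^sup>2)) + (A b - A a))"
      using ab A_mono[of a b] by (subst ennreal_plus) (auto simp: ennreal_mult)
    also have "\<kappa>\<^sup>2 * (pi * (b\<^sup>2 - a\<^sup>2)) + (A b - A a) = 2 * \<kappa> * (pi * \<kappa> * (b\<^sup>2 - a\<^sup>2))"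
      using ab A[of a] A[of b] by (simp add: power2_eq_square algebra_simps)
    finally show ?thesis .
  qed
  finally have upper: "(\<integral>\<^sup>+w. F w \<partial>lborel) + ennreal (2 * \<kappa>) * J b
      \<le> ennreal (2 * \<kappa> * (pi * \<kappa> * (b\<^sup>2 - a\<^sup>2)))" .
  have "ennreal (2 * \<kappa>) * J b \<le> ennreal (2 * \<kappa> * (pi * \<kappa> * (b\<^sup>2 - a\<^sup>2)))"
    using order_trans[OF _ upper, of "ennreal (2 * \<kappa>) * J b"] by simp
  then have "ennreal (2 * \<kappa>) * J b < top"
    by (rule le_less_trans) simp
  \<comment> \<open>Finiteness passes to every \<open>J t\<close> and allows real arithmetic with
    \<open>J\<close> below.\<close>
  then have Jb_fin: "J b < top"
    using \<kappa> by (auto simp: ennreal_mult_less_top)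
  have J_add: "J y = J x + (\<integral>\<^sup>+w\<in>U y - U x. ennreal (m w) \<partial>lborel)" if xy: "a \<le> x" "x \<le> y" "y \<le> b" for x y
  proof -
    have "U y - U a = (U x - U a) \<union> (U y - U x)"
      using U_mono[OF xy(1)] U_mono[OF xy(2)]
      by (intro set_eqI) (simp only: Un_iff Diff_iff, meson subsetD)
    moreover have "(U x - U a) \<inter> (U y - U x) = {}"
      by (intro equals0I) (simp only: Int_iff Diff_iff, metis)
    moreover have "U x - U a \<in> sets lborel" "U y - U x \<in> sets lborel"
      using xy ab by auto
    ultimately show ?thesis
      unfolding J_def by (simp add: nn_integral_disjoint_pair)
  qed
  have J_fin: "J t = ennreal (enn2real (J t))" if "a \<le> t" "t \<le> b" for t
  proof -
    have "J t \<le> J b"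
      using J_add[of t b] that by simp
    then show ?thesis
      using Jb_fin by (auto simp: less_top)
  qed
  \<comment> \<open>A single use of the slope inequality on the whole annulus would give only
    \<open>2 * pi * \<kappa> * a * (b - a)\<close>. Summing over fine partitions yields
    \<open>pi * \<kappa> * (b^2 - a^2)\<close>, which matches the upper bound.\<close>
  have "enn2real (J a) - pi * \<kappa> * a\<^sup>2 \<le> enn2real (J b) - pi * \<kappa> * b\<^sup>2"
  proof (rule le_if_diff_ge_neg_square[where C = "pi * \<kappa>" and a = a and b = b
        and h = "\<lambda>t. enn2real (J t) - pi * \<kappa> * t\<^sup>2"])
    fix x y assume xy: "a \<le> x" "x \<le> y" "y \<le> b"
    have "sqrt (pi * A x) = sqrt ((pi * \<kappa> * x)\<^sup>2)"
      using A[of x] xy by (simp add: power2_eq_square algebra_simps)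
    also have "\<dots> = pi * \<kappa> * x"
      using \<kappa> xy ab by simp
    finally have "ennreal (2 * (pi * \<kappa> * x) * (y - x)) \<le> (\<integral>\<^sup>+w\<in>U y - U x. ennreal (m w) \<partial>lborel)"
      using slope_integral_ge[OF ms xy] by simp
    then have "J x + ennreal (2 * (pi * \<kappa> * x) * (y - x)) \<le> J y"
      using J_add[OF xy] by (simp add: add_left_mono)
    then have "ennreal (enn2real (J x) + 2 * (pi * \<kappa> * x) * (y - x)) \<le> ennreal (enn2real (J y))"
      using J_fin[of x] J_fin[of y] xy \<kappa> ab by (simp add: ennreal_plus)
    then have "enn2real (J x) + 2 * (pi * \<kappa> * x) * (y - x) \<le> enn2real (J y)"
      by simp
    then show "- (pi * \<kappa>) * (y - x)\<^sup>2 \<le> enn2real (J y) - pi * \<kappa> * y\<^sup>2 - (enn2real (J x) - pi * \<kappa> * x\<^sup>2)"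
      by (simp add: power2_eq_square algebra_simps)
  qed (use ab in simp)
  moreover have "J a = 0"
    by (simp add: J_def)
  ultimately have "pi * \<kappa> * (b\<^sup>2 - a\<^sup>2) \<le> enn2real (J b)"
    by (simp add: algebra_simps)
  then have "ennreal (pi * \<kappa> * (b\<^sup>2 - a\<^sup>2)) \<le> J b"
    using J_fin[of b] ab by (metis ennreal_leI less_imp_le order_refl)
  then have "ennreal (2 * \<kappa> * (pi * \<kappa> * (b\<^sup>2 - a\<^sup>2))) \<le> ennreal (2 * \<kappa>) * J b"
    using \<kappa> by (simp add: ennreal_mult' mult_left_mono)
  with upper have "(\<integral>\<^sup>+w. F w \<partial>lborel) + ennreal (2 * \<kappa>) * J b \<le> ennreal (2 * \<kappa>) * J b"
    by (rule order_trans)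
  then have "ennreal (2 * \<kappa>) * J b + (\<integral>\<^sup>+w. F w \<partial>lborel) \<le> ennreal (2 * \<kappa>) * J b + 0"
    by (simp only: add.commute[of "\<integral>\<^sup>+w. F w \<partial>lborel"] add_0_right)
  then have "(\<integral>\<^sup>+w. F w \<partial>lborel) = 0"
    using \<open>ennreal (2 * \<kappa>) * J b < top\<close> by (simp only: ennreal_add_left_cancel_le) auto
  then have "AE w in lborel. F w = 0"
    by (subst (asm) nn_integral_0_iff_AE) auto
  then have "AE w in lborel. \<not> (w \<in> R \<and> \<kappa> * m w \<noteq> 1)"
    by eventually_elim (auto simp: F_def indicator_def split: if_splits)
  moreover have "{w \<in> R. \<kappa> * m w \<noteq> 1} \<in> sets lborel"
    by measurable
  ultimately have "{w \<in> R. \<kappa> * m w \<noteq> 1} \<in> null_sets lborel"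
    by (simp add: AE_iff_null_sets)
  then have N: "negligible {w \<in> R. \<kappa> * m w \<noteq> 1}"
    by (simp add: negligible_iff_null_sets null_sets_completionI)
  \<comment> \<open>As \<open>f\<close> is not linear, \<open>cmod (deriv f z) = \<kappa>\<close>
    holds only on a null set, whose image under \<open>f\<close> is null too. Almost every point of
    \<open>R\<close> lies in this image, so \<open>R\<close> is null, contradicting
    \<open>A a < A b\<close>.\<close>
  define Z where "Z = {z \<in> cball 0 b. cmod (deriv f z) = \<kappa>}"
  have "\<exists>z\<in>ball 0 1. deriv (deriv f) z \<noteq> 0"
    using linear_on_disc_if_deriv_deriv_zero[OF hol] nonlinear by blast
  then have "negligible Z"
    unfolding Z_def using ab
    by (intro negligible_level_set_cmod[OF holomorphic_deriv[OF hol open_ball] open_ball]) auto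
  then have "negligible (f ` Z)"
  proof (rule negligible_differentiable_image_negligible[rotated])
    show "f differentiable_on Z"
      using ab by (intro differentiable_on_subset[OF holomorphic_on_imp_differentiable_on[OF hol]])
        (auto simp: Z_def)
  qed simp
  then have "negligible ({w \<in> R. \<kappa> * m w \<noteq> 1} \<union> f ` Z)"
    using N by (intro negligible_Un)
  moreover have "R \<subseteq> {w \<in> R. \<kappa> * m w \<noteq> 1} \<union> f ` Z"
  proof
    fix w assume w: "w \<in> R"
    show "w \<in> {w \<in> R. \<kappa> * m w \<noteq> 1} \<union> f ` Z"
    proof (cases "\<kappa> * m w = 1")
      case True
      obtain z where z: "cmod z \<le> b" "f z = w" "m w = 1 / cmod (deriv f z)"
        using m(3)[of w] w unfolding R_def by metis
      then have "z \<in> Z"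
        using True by (auto simp: Z_def divide_eq_eq split: if_splits)
      then show ?thesis
        using z(2) by (intro UnI2 image_eqI[of _ _ z]) auto
    qed (use w in simp)
  qed
  ultimately have "negligible R"
    by (rule negligible_subset)
  then have "emeasure lborel R = 0"
    using R by (simp add: negligible_iff_emeasure0)
  then have "A b - A a \<le> 0"
    using ab emeasure_U_diff[of a b] by (simp add: R_def ennreal_eq_0_iff)
  moreover have "A a < A b"
    using A[of a] A[of b] ab \<kappa> by (simp add: power_strict_mono)
  ultimately show False by simp
qed

end

section \<open>From annuli to the whole disc\<close>

text \<open>The local condition compares values only with the centre \<open>c\<close>. The set of
  \<open>t\<close> up to which \<open>g\<close> stays above \<open>g x\<close> has supremum
  \<open>y\<close>: at a smaller supremum the condition there would extend it further.\<close>

lemma strict_mono_on_if_locally: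
  fixes g :: "real \<Rightarrow> real"
  assumes loc: "\<And>c. a < c \<Longrightarrow> c < b \<Longrightarrow>
    \<exists>e>0. (\<forall>x. c - e < x \<and> x < c \<longrightarrow> g x < g c) \<and> (\<forall>y. c < y \<and> y < c + e \<longrightarrow> g c < g y)"
  shows "strict_mono_on {a<..<b} g"
proof (rule strict_mono_onI)
  fix x y assume xy: "x \<in> {a<..<b}" "y \<in> {a<..<b}" "x < y"
  define T where "T = {t \<in> {x..y}. \<forall>u\<in>{x<..t}. g x < g u}"
  have "x \<in> T" using xy by (auto simp: T_def)
  have bdd: "bdd_above T" by (rule bdd_aboveI[of _ y]) (auto simp: T_def)
  define s where "s = Sup T"
  have "s \<le> y"
    unfolding s_def by (rule cSup_least) (use \<open>x \<in> T\<close> in \<open>auto simp: T_def\<close>)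
  moreover have "x \<le> s"
    unfolding s_def using \<open>x \<in> T\<close> bdd by (rule cSup_upper)
  ultimately have s: "x \<le> s" "s \<le> y" by simp_all
  obtain e where e: "e > 0" "\<And>u. s - e < u \<Longrightarrow> u < s \<Longrightarrow> g u < g s" "\<And>u. s < u \<Longrightarrow> u < s + e \<Longrightarrow> g s < g u"
    using loc[of s] s xy by auto
  have below: "g x < g u" if u: "x < u" "u < s" for u
  proof -
    obtain t where "t \<in> T" "u < t"
      using less_cSupD[of T u] u \<open>x \<in> T\<close> by (auto simp: s_def)
    then show ?thesis
      using u by (auto simp: T_def)
  qed
  have at_s: "g x < g s" if xs: "x < s"
  proof -
    obtain u where u: "max x (s - e) < u" "u < s"
      using dense[of "max x (s - e)" s] xs e(1) by auto
    then show ?thesis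
      using below[of u] e(2)[of u] by auto
  qed
  have "s = y"
  proof (rule ccontr)
    assume "s \<noteq> y"
    then have "s < y" using s by simp
    define v where "v = min y (s + e / 2)"
    have "g x < g u" if "x < u" "u \<le> v" for u
    proof (cases u s rule: linorder_cases)
      case greater
      then have "g s < g u"
        using that e(1) by (intro e(3)) (auto simp: v_def min_def split: if_splits)
      moreover have "g x \<le> g s"
        using at_s s(1) by (cases "x = s") auto
      ultimately show ?thesis by simp
    qed (use that below at_s in auto)
    then have "v \<in> T"
      using s \<open>s < y\<close> e(1) by (auto simp: T_def v_def)
    then have "v \<le> s"
      unfolding s_def using bdd by (rule cSup_upper)
    then show False
      using \<open>s < y\<close> e(1) by (auto simp: v_def)
  qed
  then show "g x < g y"
    using at_s xy by simp
qed

text \<open>Only the denominator passes to the limit. With \<open>M\<close> a multiple of the area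
  at radius \<open>c\<close>, monotonicity of the area takes the place of its continuity.\<close>

lemma le_if_le_left_limit:
  fixes k M c :: real
  assumes "0 < c" "x < c" and le: "\<And>t. x < t \<Longrightarrow> t < c \<Longrightarrow> k \<le> M / t\<^sup>2"
  shows "k \<le> M / c\<^sup>2"
proof (rule tendsto_lowerbound)
  show "((\<lambda>t. M / t\<^sup>2) \<longlongrightarrow> M / c\<^sup>2) (at_left c)"
    using assms(1) by (intro tendsto_intros) auto
  show "eventually (\<lambda>t. k \<le> M / t\<^sup>2) (at_left c)"
    using assms(2) le by (auto simp: eventually_at_left)
qed simp

lemma ge_if_ge_right_limit:
  fixes k M c :: real
  assumes "0 < c" "c < y" and ge: "\<And>t. c < t \<Longrightarrow> t < y \<Longrightarrow> M / t\<^sup>2 \<le> k"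
  shows "M / c\<^sup>2 \<le> k"
proof (rule tendsto_upperbound)
  show "((\<lambda>t. M / t\<^sup>2) \<longlongrightarrow> M / c\<^sup>2) (at_right c)"
    using assms(1) by (intro tendsto_intros) auto
  show "eventually (\<lambda>t. M / t\<^sup>2 \<le> k) (at_right c)"
    using assms(2) ge by (auto simp: eventually_at_right)
qed simp

text \<open>A smaller closed disc contains finitely many critical points, so radii close to
  \<open>c\<close> on one side of it bound regular annuli. The radius \<open>c\<close> itself,
  possibly critical, is reached by one-sided limits that use monotonicity of the area.\<close>

lemma phi_area_locally_strict_mono:
  assumes f: "f holomorphic_on ball 0 1" and nonlinear: "\<not> linear_on_disc f" and c: "0 < c" "c < 1"
  shows "\<exists>e>0. (\<forall>x. c - e < x \<and> x < c \<longrightarrow> phi_area f x < phi_area f c)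
    \<and> (\<forall>y. c < y \<and> y < c + e \<longrightarrow> phi_area f c < phi_area f y)"
proof -
  have nc: "\<not> deriv f constant_on ball 0 1"
  proof
    assume "deriv f constant_on ball 0 1"
    then obtain k where k: "\<And>z. z \<in> ball 0 1 \<Longrightarrow> deriv f z = k"
      by (auto simp: constant_on_def)
    have "deriv (deriv f) z = 0" if z: "z \<in> ball 0 1" for z
    proof -
      have "deriv (deriv f) z = deriv (\<lambda>_. k) z"
        by (rule complex_derivative_transform_within_open[OF holomorphic_deriv[OF f open_ball] _ open_ball z])
          (auto simp: k)
      then show ?thesis by simp
    qed
    then show False
      using linear_on_disc_if_deriv_deriv_zero[OF f] nonlinear by blast
  qed
  define r where "r = (1 + c) / 2"
  have r: "c < r" "r < 1" using c by (auto simp: r_def)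
  define Z where "Z = {z \<in> cball 0 r. deriv f z = 0}"
  have "finite Z"
    unfolding Z_def using r
    by (intro holomorphic_compact_finite_zeros[OF holomorphic_deriv[OF f open_ball] open_ball _ _ _ nc]) auto
  then obtain d where d: "d > 0" "\<And>z. z \<in> Z \<Longrightarrow> cmod z \<noteq> c \<Longrightarrow> d \<le> dist c (cmod z)"
    using finite_set_avoid[of "cmod ` Z" c] by auto
  \<comment> \<open>\<open>d\<close> keeps away from the other critical moduli, \<open>c\<close>
    keeps the radii positive, and \<open>r - c\<close> keeps them below \<open>r\<close>.\<close>
  define e where "e = min d (min c (r - c))"
  have e: "e > 0" "e \<le> d" "e \<le> c" "c + e \<le> r"
    using d(1) c r by (auto simp: e_def)
  have annulus: "regular_annulus f x y"
    if xy: "c - e < x" "x < y" "y < c + e" "y < c \<or> c < x" for x y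
  proof
    show "f holomorphic_on ball 0 1" by fact
    show "0 < x" "x < y" "y < 1"
      using xy e r by auto
    show "deriv f z \<noteq> 0" if z: "x \<le> cmod z" "cmod z \<le> y" for z
    proof
      assume "deriv f z = 0"
      then have "z \<in> Z"
        using z xy e by (auto simp: Z_def)
      then show False
        using d(2)[of z] z xy e by (auto simp: dist_real_def)
    qed
  qed
  define B where "B t = measure lebesgue (f ` ball 0 t) / pi" for t
  have phi: "phi_area f t = B t / t\<^sup>2" for t
    by (simp add: phi_area_def B_def)
  have strict: "phi_area f x < phi_area f y"
    if xy: "c - e < x" "x < y" "y < c + e" "y < c \<or> c < x" for x y
  proof -
    interpret regular_annulus f x y by (rule annulus[OF xy])
    have "B t = A t / pi" if "t \<le> 1" for t
      using U_sets[OF that] by (simp add: B_def A_def)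
    moreover have "A x / x\<^sup>2 / pi < A y / y\<^sup>2 / pi"
      by (intro divide_strict_right_mono area_ratio_strict_mono nonlinear) simp
    ultimately show ?thesis
      using ab by (simp add: phi mult.commute)
  qed
  have B_mono: "B s \<le> B t" if "s \<le> t" "t < 1" for s t
  proof -
    \<comment> \<open>Any annulus to the left of \<open>c\<close> will do: it instantiates the
      locale, whose \<open>A_mono\<close> then covers all radii below 1.\<close>
    obtain x y where "c - e < x" "x < y" "y < c"
      using e(1) dense[of "c - e" c] dense by (metis diff_less_eq less_add_same_cancel1)
    then interpret regular_annulus f x y
      using e by (intro annulus) auto
    have "B q = A q / pi" if "q \<le> 1" for q
      using U_sets[OF that] by (simp add: B_def A_def)
    then show ?thesis
      using A_mono[OF that] that by (simp add: divide_right_mono)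
  qed
  have "phi_area f x < phi_area f c" if x: "c - e < x" "x < c" for x
  proof -
    \<comment> \<open>The limit at \<open>c\<close> yields a weak inequality only; strictness comes
      from the intermediate radius \<open>x0\<close>.\<close>
    obtain x0 where x0: "x < x0" "x0 < c"
      using dense x by blast
    have "phi_area f x0 \<le> B c / c\<^sup>2"
    proof (rule le_if_le_left_limit[OF c(1) x0(2)])
      fix t assume t: "x0 < t" "t < c"
      have "phi_area f x0 \<le> B t / t\<^sup>2"
        using strict[of x0 t] x x0 t e by (simp add: phi)
      also have "\<dots> \<le> B c / t\<^sup>2"
        using B_mono[of t c] t c by (intro divide_right_mono) auto
      finally show "phi_area f x0 \<le> B c / t\<^sup>2" .
    qed
    moreover have "phi_area f x < phi_area f x0"
      using x x0 e by (intro strict) auto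
    ultimately show ?thesis
      by (simp add: phi)
  qed
  moreover have "phi_area f c < phi_area f y" if y: "c < y" "y < c + e" for y
  proof -
    obtain y0 where y0: "c < y0" "y0 < y"
      using dense y by blast
    have "B c / c\<^sup>2 \<le> phi_area f y0"
    proof (rule ge_if_ge_right_limit[OF c(1) y0(1)])
      fix t assume t: "c < t" "t < y0"
      have "B c / t\<^sup>2 \<le> B t / t\<^sup>2"
        using B_mono[of c t] t y0 y e r by (intro divide_right_mono) auto
      also have "\<dots> \<le> phi_area f y0"
        using strict[of t y0] y y0 t e by (simp add: phi)
      finally show "B c / t\<^sup>2 \<le> phi_area f y0" .
    qed
    moreover have "phi_area f y0 < phi_area f y"
      using y y0 e by (intro strict) auto
    ultimately show ?thesis
      by (simp add: phi)
  qed
  ultimately show ?thesis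
    using e(1) by blast
qed

lemma phi_area_linear:
  assumes f: "\<And>z. z \<in> ball 0 1 \<Longrightarrow> f z = a * z + b" and r: "0 < r" "r < 1"
  shows "phi_area f r = (cmod a)\<^sup>2"
proof (cases "a = 0")
  case True
  then have "f ` ball 0 r \<subseteq> {b}"
    using f r by force
  then have "negligible (f ` ball 0 r)"
    by (rule negligible_subset[OF negligible_sing])
  then have "measure lebesgue (f ` ball 0 r) = 0"
    by (rule negligible_imp_measure0)
  then show ?thesis
    using True by (simp add: phi_area_def)
next
  case False
  have "f ` ball 0 r = ball b (cmod a * r)"
  proof (intro equalityI subsetI)
    fix w assume "w \<in> f ` ball 0 r"
    then obtain z where "cmod z < r" "w = f z" by auto
    then show "w \<in> ball b (cmod a * r)"
      using f[of z] r False by (simp add: dist_norm norm_mult)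
  next
    fix w assume w: "w \<in> ball b (cmod a * r)"
    have z: "cmod ((w - b) / a) < r"
      using w False by (simp add: norm_divide dist_norm norm_minus_commute divide_less_eq mult.commute)
    then show "w \<in> f ` ball 0 r"
      using f[of "(w - b) / a"] r False by (intro image_eqI[of _ _ "(w - b) / a"]) auto
  qed
  then have "measure lebesgue (f ` ball 0 r) = pi * (cmod a * r)\<^sup>2"
    using r False by (simp add: content_ball unit_ball_vol_2)
  then show ?thesis
    using r by (simp add: phi_area_def power_mult_distrib)
qed

theorem theorem1p9:
  fixes f :: "complex \<Rightarrow> complex"
  assumes "f holomorphic_on ball 0 1"
  shows "(linear_on_disc f \<longrightarrow> (\<exists>c. \<forall>r\<in>{0<..<1}. phi_area f r = c))
       \<and> (\<not> linear_on_disc f \<longrightarrow> strict_mono_on {0<..<1} (phi_area f))"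
proof (intro conjI impI)
  assume "linear_on_disc f"
  then obtain a b where "\<And>z. z \<in> ball 0 1 \<Longrightarrow> f z = a * z + b"
    by (auto simp: linear_on_disc_def)
  then have "phi_area f r = (cmod a)\<^sup>2" if "r \<in> {0<..<1}" for r
    using that by (intro phi_area_linear[of f a b]) auto
  then show "\<exists>c. \<forall>r\<in>{0<..<1}. phi_area f r = c" by blast
next
  assume "\<not> linear_on_disc f"
  then show "strict_mono_on {0<..<1} (phi_area f)"
    using phi_area_locally_strict_mono[OF assms] by (intro strict_mono_on_if_locally) auto
qed

end
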